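(* Let $\Omega\subsetneq\mathcal{X}$ be a Kobayashi hyperbolic domain of a complex manifold $\mathcal{X}$, with $\overline\Omega^{\mathrm{End}}$ sequentially compact, and let $o\in\Omega$ be a fixed point. Then the following are equivalent: (1) For every $x\in\partial\overline\Omega^{\mathrm{End}}$, the limit $\lim_{w\to x}(\mathsf{k}_\Omega(z,w)-\mathsf{k}_\Omega(o,w))$ exists for all $z\in\Omega$. (2) For every $x\in\partial\overline\Omega^{\mathrm{End}}$, the set $\mathscr{H}(x)$ is a singleton. (3) The map $i_{\mathsf{k}}$ extends continuously to a map $\overline\Omega^{\mathrm{End}}\to\overline\Omega^{\mathsf{k}}$, i.e. there is a continuous map $G:\overline\Omega^{\mathrm{End}}\to\overline\Omega^{\mathsf{k}}$ with $G|_\Omega=i_{\mathsf{k}}$.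
   Context: $\mathsf{k}_\Omega$ is the Kobayashi distance of $\Omega$; $\Omega$ is Kobayashi hyperbolic if $\mathsf{k}_\Omega$ is a genuine distance. A domain is a nonempty connected open set; $\overline\Omega$ is the closure of $\Omega$ in $\mathcal{X}$. Limits $w\to x$ are taken with $w\in\Omega$, in the topology of $\overline\Omega^{\mathrm{End}}$. End compactification: let $(K_j)_{j\ge1}$ be an exhaustion of $\overline\Omega$ by compact sets with $K_j\subset\mathrm{int}(K_{j+1})$. An end is a sequence $(F_j)_{j\ge1}$ where $F_j$ is a connected component of $\overline\Omega\setminus K_j$ and $F_{j+1}\subset F_j$. With $\mathcal{E}$ the set of ends, $\overline\Omega^{\mathrm{End}}=\overline\Omega\sqcup\mathcal{E}$. A neighbourhood basis at $x\in\overline\Omega$ is given by the sets $U\cap\overline\Omega$, $U$ a neighbourhood of $x$ in $\mathcal{X}$; at an end $e=(F_j)$ it is given by $\widehat F_j=F_j\sqcup\{(G_\nu)\in\mathcal{E}: G_\nu=F_\nu,\ \nu=1,\dots,j\}$, $j\ge1$. This is a first-countable Hausdorff topology independent of the exhaustion. $\partial\overline\Omega^{\mathrm{End}}=\overline\Omega^{\mathrm{End}}\setminus\Omega$. Metric compactification of $(\Omega,\mathsf{k}_\Omega)$: let $C(\Omega)$ be the real-valued continuous functions on $\Omega$ with the topology of local uniform convergence, $C_*(\Omega)$ its quotient by the constant functions with the quotient topology, and $i_{\mathsf{k}}:\Omega\to C_*(\Omega)$, $i_{\mathsf{k}}(x)=[\mathsf{k}_\Omega(x,\cdot)]$. Then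 $\overline\Omega^{\mathsf{k}}$ is the closure of $i_{\mathsf{k}}(\Omega)$ in $C_*(\Omega)$. For $x\in\partial\overline\Omega^{\mathrm{End}}$: $\mathscr{H}(x)=\{\xi\in\overline\Omega^{\mathsf{k}}\setminus i_{\mathsf{k}}(\Omega): \exists (x_n)\subset\Omega \text{ with } x_n\to x \text{ in } \overline\Omega^{\mathrm{End}} \text{ and } i_{\mathsf{k}}(x_n)\to\xi\}$. *)

theory Defs
  imports "HOL-Analysis.Analysis"
begin

section \<open>Complex manifolds\<close>

definition holomorphic_map_on :: "(complex ^ 'n \<Rightarrow> complex ^ 'm) \<Rightarrow> (complex ^ 'n) set \<Rightarrow> bool" where
  "holomorphic_map_on f S \<longleftrightarrow>
     (\<forall>z\<in>S. \<exists>f'. (f has_derivative f') (at z) \<and> (\<forall>c v. f' (c *s v) = c *s f' v))"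

text \<open>
  A complex manifold of dimension \<open>CARD('n)\<close> is a Hausdorff second countable type
  together with a holomorphic atlas. A chart is a pair of a domain and a coordinate map;
  the values of a coordinate map outside its domain are irrelevant. Connectedness of the
  ambient manifold is not required.
\<close>

definition complex_atlas ::
    "('a::{t2_space,second_countable_topology} set \<times> ('a \<Rightarrow> complex ^ 'n)) set \<Rightarrow> bool" where
  "complex_atlas A \<longleftrightarrow>
     (\<forall>(U, \<phi>)\<in>A. open U \<and> open (\<phi> ` U) \<and> (\<exists>\<psi>. homeomorphism U (\<phi> ` U) \<phi> \<psi>)) \<and>
     (\<Union>(U, \<phi>)\<in>A. U) = UNIV \<and>
     (\<forall>(U, \<phi>)\<in>A. \<forall>(V, \<psi>)\<in>A. holomorphic_map_on (\<psi> \<circ> inv_into U \<phi>) (\<phi> ` (U \<inter> V)))"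

section \<open>The Kobayashi distance\<close>

definition holomorphic_discs ::
    "('a::{t2_space,second_countable_topology} set \<times> ('a \<Rightarrow> complex ^ 'n)) set
       \<Rightarrow> 'a set \<Rightarrow> (complex \<Rightarrow> 'a) set" where
  "holomorphic_discs A \<Omega> =
     {f. f ` ball 0 1 \<subseteq> \<Omega> \<and> continuous_on (ball 0 1) f \<and>
         (\<forall>(U, \<phi>)\<in>A. \<forall>i. (\<lambda>\<zeta>. \<phi> (f \<zeta>) $ i) holomorphic_on {\<zeta> \<in> ball 0 1. f \<zeta> \<in> U})}"

text \<open>
  The Poincare distance of the unit disc, normalised to have curvature \<open>-4\<close>. Another
  normalisation multiplies the Kobayashi distance by a positive constant.
\<close>

definition poincare_dist :: "complex \<Rightarrow> complex \<Rightarrow> real" where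
  "poincare_dist a b = artanh (cmod ((a - b) / (1 - cnj b * a)))"

fun disc_chain ::
    "('a::{t2_space,second_countable_topology} set \<times> ('a \<Rightarrow> complex ^ 'n)) set \<Rightarrow> 'a set
       \<Rightarrow> 'a \<Rightarrow> ((complex \<Rightarrow> 'a) \<times> complex \<times> complex) list \<Rightarrow> 'a \<Rightarrow> bool" where
  "disc_chain A \<Omega> z [] w \<longleftrightarrow> z = w"
| "disc_chain A \<Omega> z ((f, a, b) # cs) w \<longleftrightarrow>
     f \<in> holomorphic_discs A \<Omega> \<and> a \<in> ball 0 1 \<and> b \<in> ball 0 1 \<and> f a = z \<and>
     disc_chain A \<Omega> (f b) cs w"

text \<open>
  Meaningful for \<open>z, w \<in> \<Omega>\<close> with \<open>\<Omega>\<close> connected and open: then the set of chains from \<open>z\<close>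
  to \<open>w\<close> is nonempty, and the infimum is a nonnegative real number.
\<close>

definition kobayashi_dist ::
    "('a::{t2_space,second_countable_topology} set \<times> ('a \<Rightarrow> complex ^ 'n)) set
       \<Rightarrow> 'a set \<Rightarrow> 'a \<Rightarrow> 'a \<Rightarrow> real" where
  "kobayashi_dist A \<Omega> z w =
     Inf {(\<Sum>(f, a, b)\<leftarrow>cs. poincare_dist a b) | cs. disc_chain A \<Omega> z cs w}"

text \<open>
  The distance is cut off outside \<open>\<Omega>\<close> because \<^locale>\<open>Metric_space\<close> demands nonnegativity
  and symmetry on the whole type.
\<close>

definition kobayashi_hyperbolic ::
    "('a::{t2_space,second_countable_topology} set \<times> ('a \<Rightarrow> complex ^ 'n)) set
       \<Rightarrow> 'a set \<Rightarrow> bool" where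
  "kobayashi_hyperbolic A \<Omega> \<longleftrightarrow>
     Metric_space \<Omega> (\<lambda>z w. if z \<in> \<Omega> \<and> w \<in> \<Omega> then kobayashi_dist A \<Omega> z w else 0)"

section \<open>The end compactification\<close>

text \<open>
  Exhaustions and ends are indexed from \<open>0\<close>. Interiors are taken relative to the closure
  of \<open>\<Omega>\<close>.
\<close>

definition compact_exhaustion :: "'a::topological_space set \<Rightarrow> (nat \<Rightarrow> 'a set) \<Rightarrow> bool" where
  "compact_exhaustion S K \<longleftrightarrow>
     (\<forall>j. compact (K j) \<and> K j \<subseteq> S) \<and> (\<Union>j. K j) = S \<and>
     (\<forall>j. K j \<subseteq> (top_of_set S) interior_of (K (Suc j)))"

definition ends :: "'a::topological_space set \<Rightarrow> (nat \<Rightarrow> 'a set) \<Rightarrow> (nat \<Rightarrow> 'a set) set" where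
  "ends \<Omega> K = {F. \<forall>j. F j \<in> components (closure \<Omega> - K j) \<and> F (Suc j) \<subseteq> F j}"

definition end_nbhd :: "'a::topological_space set \<Rightarrow> (nat \<Rightarrow> 'a set) \<Rightarrow> (nat \<Rightarrow> 'a set) \<Rightarrow> nat
    \<Rightarrow> ('a + (nat \<Rightarrow> 'a set)) set" where
  "end_nbhd \<Omega> K F j = Inl ` F j \<union> Inr ` {G \<in> ends \<Omega> K. \<forall>\<nu>\<le>j. G \<nu> = F \<nu>}"

definition end_open :: "'a::topological_space set \<Rightarrow> (nat \<Rightarrow> 'a set)
    \<Rightarrow> ('a + (nat \<Rightarrow> 'a set)) set \<Rightarrow> bool" where
  "end_open \<Omega> K W \<longleftrightarrow>
     W \<subseteq> Inl ` closure \<Omega> \<union> Inr ` ends \<Omega> K \<and>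
     (\<forall>x. Inl x \<in> W \<longrightarrow> (\<exists>U. open U \<and> x \<in> U \<and> Inl ` (U \<inter> closure \<Omega>) \<subseteq> W)) \<and>
     (\<forall>F. Inr F \<in> W \<longrightarrow> (\<exists>j. end_nbhd \<Omega> K F j \<subseteq> W))"

definition end_topology :: "'a::topological_space set \<Rightarrow> (nat \<Rightarrow> 'a set)
    \<Rightarrow> ('a + (nat \<Rightarrow> 'a set)) topology" where
  "end_topology \<Omega> K = topology (end_open \<Omega> K)"

definition end_boundary :: "'a::topological_space set \<Rightarrow> (nat \<Rightarrow> 'a set)
    \<Rightarrow> ('a + (nat \<Rightarrow> 'a set)) set" where
  "end_boundary \<Omega> K = topspace (end_topology \<Omega> K) - Inl ` \<Omega>"

lemma end_nbhd_antimono: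
  assumes "F \<in> ends \<Omega> K" "i \<le> j"
  shows "end_nbhd \<Omega> K F j \<subseteq> end_nbhd \<Omega> K F i"
proof -
  have "F (Suc n) \<subseteq> F n" for n
    using assms(1) by (simp add: ends_def)
  then have "F j \<subseteq> F i"
    using assms(2) by (rule lift_Suc_antimono_le)
  moreover have "{G \<in> ends \<Omega> K. \<forall>\<nu>\<le>j. G \<nu> = F \<nu>} \<subseteq> {G \<in> ends \<Omega> K. \<forall>\<nu>\<le>i. G \<nu> = F \<nu>}"
    using assms(2) by (intro Collect_mono) simp
  ultimately show ?thesis
    unfolding end_nbhd_def by (intro Un_mono image_mono)
qed

lemma end_openD:
  assumes "end_open \<Omega> K W"
  shows "W \<subseteq> Inl ` closure \<Omega> \<union> Inr ` ends \<Omega> K"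
    and "Inl x \<in> W \<Longrightarrow> \<exists>U. open U \<and> x \<in> U \<and> Inl ` (U \<inter> closure \<Omega>) \<subseteq> W"
    and "Inr F \<in> W \<Longrightarrow> \<exists>j. end_nbhd \<Omega> K F j \<subseteq> W"
  using assms by (simp_all add: end_open_def)

lemma end_openI:
  assumes "W \<subseteq> Inl ` closure \<Omega> \<union> Inr ` ends \<Omega> K"
    and "\<And>x. Inl x \<in> W \<Longrightarrow> \<exists>U. open U \<and> x \<in> U \<and> Inl ` (U \<inter> closure \<Omega>) \<subseteq> W"
    and "\<And>F. Inr F \<in> W \<Longrightarrow> \<exists>j. end_nbhd \<Omega> K F j \<subseteq> W"
  shows "end_open \<Omega> K W"
  using assms by (simp add: end_open_def)

lemma istopology_end_open: "istopology (end_open \<Omega> K)"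
  unfolding istopology_def
proof (intro conjI allI impI)
  fix V W assume V: "end_open \<Omega> K V" and W: "end_open \<Omega> K W"
  show "end_open \<Omega> K (V \<inter> W)"
  proof (rule end_openI)
    show "V \<inter> W \<subseteq> Inl ` closure \<Omega> \<union> Inr ` ends \<Omega> K"
      using end_openD(1)[OF V] by (rule le_infI1)
  next
    fix x assume x: "Inl x \<in> V \<inter> W"
    obtain U1 where U1: "open U1" "x \<in> U1" "Inl ` (U1 \<inter> closure \<Omega>) \<subseteq> V"
      using end_openD(2)[OF V, of x] x by (meson IntD1)
    obtain U2 where U2: "open U2" "x \<in> U2" "Inl ` (U2 \<inter> closure \<Omega>) \<subseteq> W"
      using end_openD(2)[OF W, of x] x by (meson IntD2)
    have "Inl ` (U1 \<inter> U2 \<inter> closure \<Omega>) \<subseteq> V \<inter> W"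
      using U1(3) U2(3) by (simp add: image_subset_iff)
    then show "\<exists>U. open U \<and> x \<in> U \<and> Inl ` (U \<inter> closure \<Omega>) \<subseteq> V \<inter> W"
      using U1 U2 by (intro exI[of _ "U1 \<inter> U2"]) (simp add: open_Int)
  next
    fix F assume F: "Inr F \<in> V \<inter> W"
    obtain i where i: "end_nbhd \<Omega> K F i \<subseteq> V"
      using end_openD(3)[OF V, of F] F by (meson IntD1)
    obtain j where j: "end_nbhd \<Omega> K F j \<subseteq> W"
      using end_openD(3)[OF W, of F] F by (meson IntD2)
    have "Inr F \<in> Inl ` closure \<Omega> \<union> Inr ` ends \<Omega> K"
      using end_openD(1)[OF V] F by (meson IntD1 subsetD)
    then have "F \<in> ends \<Omega> K"
      by (simp add: image_iff)
    then have "end_nbhd \<Omega> K F (max i j) \<subseteq> V \<inter> W"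
      using end_nbhd_antimono[of F \<Omega> K i "max i j"] end_nbhd_antimono[of F \<Omega> K j "max i j"]
        order_trans[OF _ i] order_trans[OF _ j] by (simp add: le_infI)
    then show "\<exists>j. end_nbhd \<Omega> K F j \<subseteq> V \<inter> W" ..
  qed
next
  fix \<W> assume *: "\<forall>W\<in>\<W>. end_open \<Omega> K W"
  show "end_open \<Omega> K (\<Union>\<W>)"
  proof (rule end_openI)
    show "\<Union>\<W> \<subseteq> Inl ` closure \<Omega> \<union> Inr ` ends \<Omega> K"
      using * by (intro Sup_least) (simp add: end_openD(1))
  next
    fix x assume "Inl x \<in> \<Union>\<W>"
    then obtain W where W: "W \<in> \<W>" "Inl x \<in> W" by (elim UnionE)
    then obtain U where U: "open U" "x \<in> U" "Inl ` (U \<inter> closure \<Omega>) \<subseteq> W"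
      using end_openD(2)[of \<Omega> K W x] * by meson
    from U(3) have "Inl ` (U \<inter> closure \<Omega>) \<subseteq> \<Union>\<W>"
      by (rule order_trans[OF _ Union_upper[OF W(1)]])
    with U(1,2) show "\<exists>U. open U \<and> x \<in> U \<and> Inl ` (U \<inter> closure \<Omega>) \<subseteq> \<Union>\<W>"
      by (intro exI[of _ U] conjI)
  next
    fix F assume "Inr F \<in> \<Union>\<W>"
    then obtain W where W: "W \<in> \<W>" "Inr F \<in> W" by (elim UnionE)
    then obtain j where "end_nbhd \<Omega> K F j \<subseteq> W"
      using end_openD(3)[of \<Omega> K W F] * by meson
    then have "end_nbhd \<Omega> K F j \<subseteq> \<Union>\<W>"
      by (rule order_trans[OF _ Union_upper[OF W(1)]])
    then show "\<exists>j. end_nbhd \<Omega> K F j \<subseteq> \<Union>\<W>" ..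
  qed
qed

lemma openin_end_topology: "openin (end_topology \<Omega> K) = end_open \<Omega> K"
  unfolding end_topology_def by (rule topology_inverse'[OF istopology_end_open])

lemma topspace_end_topology:
  "topspace (end_topology \<Omega> K) = Inl ` closure \<Omega> \<union> Inr ` ends \<Omega> K" (is "_ = ?E")
proof
  show "topspace (end_topology \<Omega> K) \<subseteq> ?E"
    unfolding topspace_def openin_end_topology by (intro Sup_least) (simp add: end_openD(1))
  have "end_open \<Omega> K ?E"
  proof (rule end_openI)
    fix x assume "Inl x \<in> ?E"
    then show "\<exists>U. open U \<and> x \<in> U \<and> Inl ` (U \<inter> closure \<Omega>) \<subseteq> ?E"
      by (intro exI[of _ UNIV]) simp
  next
    fix F assume "Inr F \<in> ?E"
    then have "F \<in> ends \<Omega> K"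
      by (simp add: image_iff)
    then have "F 0 \<subseteq> closure \<Omega>"
      unfolding ends_def using in_components_subset by fastforce
    then have "end_nbhd \<Omega> K F 0 \<subseteq> ?E"
      unfolding end_nbhd_def by (intro Un_mono image_mono) simp_all
    then show "\<exists>j. end_nbhd \<Omega> K F j \<subseteq> ?E" ..
  qed simp
  then show "?E \<subseteq> topspace (end_topology \<Omega> K)"
    unfolding topspace_def openin_end_topology by (intro Sup_upper) simp
qed

definition sequentially_compact_space :: "'b topology \<Rightarrow> bool" where
  "sequentially_compact_space X \<longleftrightarrow>
     (\<forall>\<sigma>::nat \<Rightarrow> 'b. range \<sigma> \<subseteq> topspace X \<longrightarrow>
        (\<exists>l r. strict_mono (r :: nat \<Rightarrow> nat) \<and> limitin X (\<sigma> \<circ> r) l sequentially))"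

section \<open>The metric compactification\<close>

text \<open>
  Functions on \<open>S\<close> are represented by functions on the whole type that are \<open>undefined\<close>
  outside \<open>S\<close>.
\<close>

definition cont_funs :: "'a::topological_space set \<Rightarrow> ('a \<Rightarrow> real) set" where
  "cont_funs S = {f \<in> extensional S. continuous_on S f}"

text \<open>
  On the locally compact sets considered here, local uniform convergence is uniform
  convergence on compact subsets.
\<close>

definition luc_open :: "'a::topological_space set \<Rightarrow> ('a \<Rightarrow> real) set \<Rightarrow> bool" where
  "luc_open S W \<longleftrightarrow>
     W \<subseteq> cont_funs S \<and>
     (\<forall>f\<in>W. \<exists>C \<epsilon>. compact C \<and> C \<subseteq> S \<and> 0 < \<epsilon> \<and>
        {g \<in> cont_funs S. \<forall>x\<in>C. \<bar>g x - f x\<bar> < \<epsilon>} \<subseteq> W)"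

definition luc_topology :: "'a::topological_space set \<Rightarrow> ('a \<Rightarrow> real) topology" where
  "luc_topology S = topology (luc_open S)"

lemma istopology_luc_open: "istopology (luc_open S)"
  unfolding istopology_def
proof (intro conjI allI impI)
  fix V W assume V: "luc_open S V" and W: "luc_open S W"
  show "luc_open S (V \<inter> W)"
    unfolding luc_open_def
  proof (intro conjI ballI)
    show "V \<inter> W \<subseteq> cont_funs S"
      using V unfolding luc_open_def by blast
    fix f assume "f \<in> V \<inter> W"
    then obtain C1 C2 e1 e2 where
      "compact C1" "C1 \<subseteq> S" "0 < e1" "{g \<in> cont_funs S. \<forall>x\<in>C1. \<bar>g x - f x\<bar> < e1} \<subseteq> V"
      "compact C2" "C2 \<subseteq> S" "0 < e2" "{g \<in> cont_funs S. \<forall>x\<in>C2. \<bar>g x - f x\<bar> < e2} \<subseteq> W"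
      using V W unfolding luc_open_def by (meson IntD1 IntD2)
    then show "\<exists>C \<epsilon>. compact C \<and> C \<subseteq> S \<and> 0 < \<epsilon> \<and>
        {g \<in> cont_funs S. \<forall>x\<in>C. \<bar>g x - f x\<bar> < \<epsilon>} \<subseteq> V \<inter> W"
      by (intro exI[of _ "C1 \<union> C2"] exI[of _ "min e1 e2"]) auto
  qed
next
  fix \<W> assume *: "\<forall>W\<in>\<W>. luc_open S W"
  show "luc_open S (\<Union>\<W>)"
    unfolding luc_open_def
  proof (intro conjI ballI)
    show "\<Union>\<W> \<subseteq> cont_funs S"
      using * unfolding luc_open_def by blast
    fix f assume "f \<in> \<Union>\<W>"
    then obtain W where "W \<in> \<W>" "f \<in> W" by blast
    with * obtain C e where "compact C" "C \<subseteq> S" "0 < e"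
      "{g \<in> cont_funs S. \<forall>x\<in>C. \<bar>g x - f x\<bar> < e} \<subseteq> W"
      unfolding luc_open_def by meson
    with \<open>W \<in> \<W>\<close> show "\<exists>C \<epsilon>. compact C \<and> C \<subseteq> S \<and> 0 < \<epsilon> \<and>
        {g \<in> cont_funs S. \<forall>x\<in>C. \<bar>g x - f x\<bar> < \<epsilon>} \<subseteq> \<Union>\<W>"
      by (intro exI[of _ C] exI[of _ e]) blast
  qed
qed

lemma openin_luc_topology: "openin (luc_topology S) = luc_open S"
  unfolding luc_topology_def by (rule topology_inverse'[OF istopology_luc_open])

lemma topspace_luc_topology: "topspace (luc_topology S) = cont_funs S"
proof
  show "topspace (luc_topology S) \<subseteq> cont_funs S"
    unfolding topspace_def openin_luc_topology luc_open_def by blast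
  have "luc_open S (cont_funs S)"
    unfolding luc_open_def by (auto intro!: exI[of _ "{}"] exI[of _ 1])
  then show "cont_funs S \<subseteq> topspace (luc_topology S)"
    unfolding topspace_def openin_luc_topology by blast
qed

definition mod_const :: "'a::topological_space set \<Rightarrow> (('a \<Rightarrow> real) \<times> ('a \<Rightarrow> real)) set" where
  "mod_const S =
     {(f, g). f \<in> cont_funs S \<and> g \<in> cont_funs S \<and> (\<exists>c. \<forall>x\<in>S. g x = f x + c)}"

definition quot_open :: "'a::topological_space set \<Rightarrow> ('a \<Rightarrow> real) set set \<Rightarrow> bool" where
  "quot_open S W \<longleftrightarrow>
     W \<subseteq> cont_funs S // mod_const S \<and>
     openin (luc_topology S) {f \<in> cont_funs S. mod_const S `` {f} \<in> W}"

definition quot_topology :: "'a::topological_space set \<Rightarrow> ('a \<Rightarrow> real) set topology" where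
  "quot_topology S = topology (quot_open S)"

lemma istopology_quot_open: "istopology (quot_open S)"
  unfolding istopology_def
proof (intro conjI allI impI)
  fix V W assume V: "quot_open S V" and W: "quot_open S W"
  have "{f \<in> cont_funs S. mod_const S `` {f} \<in> V \<inter> W} =
      {f \<in> cont_funs S. mod_const S `` {f} \<in> V} \<inter> {f \<in> cont_funs S. mod_const S `` {f} \<in> W}"
    by blast
  then show "quot_open S (V \<inter> W)"
    using V W unfolding quot_open_def by auto
next
  fix \<W> assume *: "\<forall>W\<in>\<W>. quot_open S W"
  have "{f \<in> cont_funs S. mod_const S `` {f} \<in> \<Union>\<W>} =
      (\<Union>W\<in>\<W>. {f \<in> cont_funs S. mod_const S `` {f} \<in> W})"
    by blast
  then show "quot_open S (\<Union>\<W>)"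
    using * unfolding quot_open_def by auto
qed

lemma openin_quot_topology: "openin (quot_topology S) = quot_open S"
  unfolding quot_topology_def by (rule topology_inverse'[OF istopology_quot_open])

lemma topspace_quot_topology: "topspace (quot_topology S) = cont_funs S // mod_const S"
proof
  show "topspace (quot_topology S) \<subseteq> cont_funs S // mod_const S"
    unfolding topspace_def openin_quot_topology quot_open_def by blast
  have "{f \<in> cont_funs S. mod_const S `` {f} \<in> cont_funs S // mod_const S} =
      topspace (luc_topology S)"
    unfolding topspace_luc_topology by (auto simp: quotientI)
  then have "quot_open S (cont_funs S // mod_const S)"
    unfolding quot_open_def by simp
  then show "cont_funs S // mod_const S \<subseteq> topspace (quot_topology S)"
    unfolding topspace_def openin_quot_topology by blast
qed

lemma quotient_map_quot_topology:
  "quotient_map (luc_topology S) (quot_topology S) (\<lambda>f. mod_const S `` {f})"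
  unfolding quotient_map_def topspace_luc_topology topspace_quot_topology
proof (intro conjI allI impI)
  show "(\<lambda>f. mod_const S `` {f}) ` cont_funs S = cont_funs S // mod_const S"
    unfolding quotient_def by blast
next
  fix U assume "U \<subseteq> cont_funs S // mod_const S"
  then show "openin (luc_topology S) {f \<in> cont_funs S. mod_const S `` {f} \<in> U} =
      openin (quot_topology S) U"
    unfolding openin_quot_topology quot_open_def by simp
qed

definition kobayashi_embedding ::
    "('a::{t2_space,second_countable_topology} set \<times> ('a \<Rightarrow> complex ^ 'n)) set
       \<Rightarrow> 'a set \<Rightarrow> 'a \<Rightarrow> ('a \<Rightarrow> real) set" where
  "kobayashi_embedding A \<Omega> x = mod_const \<Omega> `` {restrict (kobayashi_dist A \<Omega> x) \<Omega>}"

definition metric_compactification ::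
    "('a::{t2_space,second_countable_topology} set \<times> ('a \<Rightarrow> complex ^ 'n)) set
       \<Rightarrow> 'a set \<Rightarrow> ('a \<Rightarrow> real) set set" where
  "metric_compactification A \<Omega> =
     (quot_topology \<Omega>) closure_of (kobayashi_embedding A \<Omega> ` \<Omega>)"

definition horo_limits ::
    "('a::{t2_space,second_countable_topology} set \<times> ('a \<Rightarrow> complex ^ 'n)) set
       \<Rightarrow> 'a set \<Rightarrow> (nat \<Rightarrow> 'a set) \<Rightarrow> 'a + (nat \<Rightarrow> 'a set) \<Rightarrow> ('a \<Rightarrow> real) set set" where
  "horo_limits A \<Omega> K x =
     {\<xi> \<in> metric_compactification A \<Omega> - kobayashi_embedding A \<Omega> ` \<Omega>.
        \<exists>\<sigma>::nat \<Rightarrow> 'a. range \<sigma> \<subseteq> \<Omega> \<and>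
          limitin (end_topology \<Omega> K) (\<lambda>n. Inl (\<sigma> n)) x sequentially \<and>
          limitin (quot_topology \<Omega>) (\<lambda>n. kobayashi_embedding A \<Omega> (\<sigma> n)) \<xi> sequentially}"

end

theory Submission
  imports
    Defs
    "HOL-Complex_Analysis.Great_Picard"
    "HOL-Complex_Analysis.Riemann_Mapping"
begin

text \<open>
  Fix the base point \<open>o\<close> and write \<open>h\<^sub>w(z) = k(w, z) - k(w, o)\<close>. Sending a class of functions to
  its representative that vanishes at \<open>o\<close> turns the metric compactification into the closure of
  the functions \<open>h\<^sub>w\<close>. All these functions are nonexpansive for \<open>k\<close>, and \<open>k\<close> is continuous, so for
  them pointwise convergence already is locally uniform convergence, and every sequence of them has
  a convergent subsequence (\<open>nonexpansive_limitin_luc\<close>, \<open>nonexpansive_bounded_sequence_compact\<close>).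

  If all limits in (1) exist, each function \<open>w \<mapsto> h\<^sub>w(z)\<close> extends continuously to the end
  compactification, because its values lie in a regular space and \<open>\<Omega>\<close> is dense. The extensions for
  the various \<open>z\<close> together form one continuous map, by the previous remark; this is (3). If (3)
  holds, any sequence in \<open>\<Omega>\<close> that tends to a boundary point \<open>x\<close> has the limit \<open>G x\<close>, so \<open>G x\<close> is the
  only candidate for an element of \<open>\<H>(x)\<close>. If \<open>\<H>(x)\<close> is a singleton, then by compactness every
  sequence tending to \<open>x\<close> has a subsequence along which \<open>h\<^sub>w\<close> tends to the same limit; this is (1).

  Two points need more than this outline. First, \<open>\<H>(x)\<close> only consists of classes outside the image
  of \<open>\<Omega>\<close>, so a limit along a sequence that tends to the boundary must be shown not to be a class
  \<open>[k(p, \<cdot>)]\<close> with \<open>p\<close> in \<open>\<Omega>\<close>. This holds although \<open>k\<close> need not be complete, since \<open>k\<close> is an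
  inner distance: almost shortest chains of discs from \<open>w\<close> to \<open>p\<close> cross the boundary of a
  fixed compact neighbourhood of \<open>p\<close> at a point \<open>s\<close> with \<open>h\<^sub>w(s) \<lesssim> h\<^sub>w(p) - k(s, p)\<close>, whereas \<open>k(p, \<cdot>)\<close>
  is smallest at \<open>p\<close> (\<open>escaping_limit_not_in_image\<close>, \<open>disc_chain_crosses_frontier\<close>).

  Second, sequences must suffice to describe limits at the ends. The closure of \<open>\<Omega>\<close> need not be
  locally connected, so the components that define an end need not be open. Sequential compactness
  implies that all but finitely many components of the complement of a compact set stay inside a
  larger compact set, and therefore the components are open outside that larger set. This gives a
  countable basis of neighbourhoods at each end (\<open>first_countable_end_topology\<close>).
\<close>

section \<open>Compact exhaustions and neighbourhoods in the end compactification\<close>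

lemma limitin_eventually:
  assumes "limitin X f l F" "openin X U" "l \<in> U"
  shows "\<forall>\<^sub>F x in F. f x \<in> U"
  using assms by (simp add: limitin_def)

lemma compact_exhaustion_mono:
  assumes "compact_exhaustion S K" "i \<le> j"
  shows "K i \<subseteq> K j"
proof (rule lift_Suc_mono_le[OF _ assms(2)])
  show "K n \<subseteq> K (Suc n)" for n
    using assms(1) interior_of_subset[of "top_of_set S" "K (Suc n)"]
    unfolding compact_exhaustion_def by blast
qed

text \<open>
  Stated with open sets of the ambient space instead of relative interiors, which is the form that
  covering arguments use.
\<close>

lemma compact_exhaustion_local:
  assumes "compact_exhaustion S K" "x \<in> S"
  shows "\<exists>U j. open U \<and> x \<in> U \<and> U \<inter> S \<subseteq> K j"
proof -
  obtain j where j: "x \<in> K j"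
    using assms by (auto simp: compact_exhaustion_def)
  then have "x \<in> top_of_set S interior_of (K (Suc j))"
    using assms(1) by (auto simp: compact_exhaustion_def)
  then obtain T where "openin (top_of_set S) T" "x \<in> T" "T \<subseteq> K (Suc j)"
    by (auto simp: interior_of_def)
  then show ?thesis
    by (auto simp: openin_open intro!: exI[of _ "Suc j"])
qed

lemma compact_exhaustion_absorbs:
  assumes ex: "compact_exhaustion S K" and C: "compact C" "C \<subseteq> S"
  obtains j where "C \<subseteq> K j"
proof -
  have "\<forall>x\<in>C. \<exists>U j. open U \<and> x \<in> U \<and> U \<inter> S \<subseteq> K j"
  proof
    fix x assume "x \<in> C"
    with C(2) have "x \<in> S" ..
    then show "\<exists>U j. open U \<and> x \<in> U \<and> U \<inter> S \<subseteq> K j"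
      by (rule compact_exhaustion_local[OF ex])
  qed
  then obtain U j where U: "\<forall>x\<in>C. open (U x) \<and> x \<in> U x \<and> U x \<inter> S \<subseteq> K (j x)"
    by metis
  obtain T where T: "T \<subseteq> C" "finite T" "C \<subseteq> (\<Union>x\<in>T. U x)"
    by (rule compactE_image[OF C(1), of C U]) (use U in auto)
  have "C \<subseteq> K (Max (insert 0 (j ` T)))"
  proof
    fix x assume x: "x \<in> C"
    then obtain t where t: "t \<in> T" "x \<in> U t"
      using T by blast
    then have "x \<in> K (j t)"
      using U T(1) x C(2) by blast
    moreover have "j t \<le> Max (insert 0 (j ` T))"
      using t T(2) by simp
    ultimately show "x \<in> K (Max (insert 0 (j ` T)))"
      using compact_exhaustion_mono[OF ex] by blast
  qed
  then show thesis
    by (rule that)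
qed

lemma openin_diff_exhaustion:
  fixes S :: "'a::t2_space set"
  assumes "compact_exhaustion S K"
  shows "openin (top_of_set S) (S - K j)"
  using assms by (intro openin_diff openin_subtopology_self closed_subset)
    (auto simp: compact_exhaustion_def compact_imp_closed)

lemma end_openI_openin:
  assumes "openin (top_of_set (closure \<Omega>)) P" "E \<subseteq> ends \<Omega> K"
    and "\<And>F. F \<in> E \<Longrightarrow> \<exists>j. end_nbhd \<Omega> K F j \<subseteq> Inl ` P \<union> Inr ` E"
  shows "openin (end_topology \<Omega> K) (Inl ` P \<union> Inr ` E)"
proof -
  obtain T where T: "open T" "P = closure \<Omega> \<inter> T"
    using assms(1) by (auto simp: openin_open)
  show ?thesis
    unfolding openin_end_topology
  proof (rule end_openI)
    show "Inl ` P \<union> Inr ` E \<subseteq> Inl ` closure \<Omega> \<union> Inr ` ends \<Omega> K"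
      using T assms(2) by blast
    show "\<exists>U. open U \<and> x \<in> U \<and> Inl ` (U \<inter> closure \<Omega>) \<subseteq> Inl ` P \<union> Inr ` E"
      if "Inl x \<in> Inl ` P \<union> Inr ` E" for x
      using T that by (intro exI[of _ T]) auto
    show "\<exists>j. end_nbhd \<Omega> K F j \<subseteq> Inl ` P \<union> Inr ` E"
      if "Inr F \<in> Inl ` P \<union> Inr ` E" for F
      using assms(3)[of F] that by auto
  qed
qed

lemma openin_end_topology_Inl:
  assumes "openin (top_of_set (closure \<Omega>)) P"
  shows "openin (end_topology \<Omega> K) (Inl ` P)"
  using end_openI_openin[OF assms, of "{}"] by simp

lemma openin_end_topology_Inl_open:
  assumes "open U" "U \<subseteq> closure \<Omega>"
  shows "openin (end_topology \<Omega> K) (Inl ` U)"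
  using assms by (intro openin_end_topology_Inl) (auto simp: openin_open)

lemma end_mem_component:
  assumes "F \<in> ends \<Omega> K"
  shows "F j \<in> components (closure \<Omega> - K j)" "F j \<noteq> {}" "F j \<subseteq> closure \<Omega> - K j"
  using assms in_components_nonempty in_components_subset unfolding ends_def by blast+

lemma end_antimono:
  assumes "F \<in> ends \<Omega> K" "i \<le> j"
  shows "F j \<subseteq> F i"
  using assms lift_Suc_antimono_le[of F i j] by (auto simp: ends_def)

lemma end_determined_below:
  assumes "F \<in> ends \<Omega> K" "G \<in> ends \<Omega> K" "G j = F j" "i \<le> j"
  shows "G i = F i"
proof -
  have "F j \<subseteq> F i" "F j \<subseteq> G i" "F j \<noteq> {}"
    using end_antimono[OF assms(1,4)] end_antimono[OF assms(2,4)] end_mem_component(2)[OF assms(1)]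
      assms(3) by auto
  then have "G i \<inter> F i \<noteq> {}"
    by blast
  then show ?thesis
    using components_eq end_mem_component(1)[OF assms(1)] end_mem_component(1)[OF assms(2)] by blast
qed

text \<open>
  A compact set lies in some \<open>K j\<close>, so each end has a basic neighbourhood that misses it. Hence a
  sequence that tends to the boundary leaves every compact subset of \<open>\<Omega>\<close>.
\<close>

lemma openin_end_compl_compact:
  fixes \<Omega> :: "'a::t2_space set"
  assumes ex: "compact_exhaustion (closure \<Omega>) K" and C: "compact C" "C \<subseteq> closure \<Omega>"
  shows "openin (end_topology \<Omega> K) (Inl ` (closure \<Omega> - C) \<union> Inr ` ends \<Omega> K)"
proof (rule end_openI_openin)
  show "openin (top_of_set (closure \<Omega>)) (closure \<Omega> - C)"
    using C by (intro openin_diff openin_subtopology_self closed_subset) (auto simp: compact_imp_closed)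
  obtain j where "C \<subseteq> K j"
    using compact_exhaustion_absorbs[OF ex C] .
  then show "\<exists>j. end_nbhd \<Omega> K F j \<subseteq> Inl ` (closure \<Omega> - C) \<union> Inr ` ends \<Omega> K"
    if "F \<in> ends \<Omega> K" for F
    using end_mem_component(3)[OF that, of j] unfolding end_nbhd_def by (intro exI[of _ j]) blast
qed simp

section \<open>First countability of the end compactification\<close>

text \<open>
  The terms of an escaping sequence form a closed discrete set. If infinitely many of them were
  outside \<open>F j\<close>, removing these from the space would leave an open neighbourhood of the end \<open>F\<close>, so
  the sequence would not tend to \<open>F\<close>. The argument works although \<open>F j\<close> itself may fail to be open.
\<close>

lemma escaping_limit_is_end:
  fixes \<Omega> :: "'a::t2_space set"
  assumes ex: "compact_exhaustion (closure \<Omega>) K"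
    and p: "\<And>n. p n \<in> closure \<Omega> - K n"
    and lim: "limitin (end_topology \<Omega> K) (\<lambda>n. Inl (p n)) l sequentially"
  obtains F where "F \<in> ends \<Omega> K" "l = Inr F" "\<And>j. \<forall>\<^sub>F n in sequentially. p n \<in> F j"
proof -
  have far: "\<forall>\<^sub>F n in sequentially. p n \<notin> K m" for m
  proof -
    have "p n \<notin> K m" if "m \<le> n" for n
      using p[of n] compact_exhaustion_mono[OF ex that] by blast
    then show ?thesis
      unfolding eventually_sequentially by blast
  qed
  have l: "l \<in> Inl ` closure \<Omega> \<union> Inr ` ends \<Omega> K"
    using limitin_topspace[OF lim] by (simp add: topspace_end_topology)
  have "l \<notin> Inl ` closure \<Omega>"
  proof
    assume "l \<in> Inl ` closure \<Omega>"
    then obtain y where y: "y \<in> closure \<Omega>" "l = Inl y"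
      by blast
    obtain U m where U: "open U" "y \<in> U" "U \<inter> closure \<Omega> \<subseteq> K m"
      using compact_exhaustion_local[OF ex y(1)] by blast
    have "openin (end_topology \<Omega> K) (Inl ` (closure \<Omega> \<inter> U))"
      using U by (intro openin_end_topology_Inl) (auto simp: openin_open)
    then have "\<forall>\<^sub>F n in sequentially. p n \<in> K m"
      by (rule eventually_mono[OF limitin_eventually[OF lim]]) (use y U in auto)
    with far[of m] have "\<forall>\<^sub>F n in sequentially. False"
      by eventually_elim simp
    then show False
      by simp
  qed
  then obtain F where F: "F \<in> ends \<Omega> K" "l = Inr F"
    using l by blast
  have "\<forall>\<^sub>F n in sequentially. p n \<in> F j" for j
  proof -
    let ?P = "{p n | n. p n \<notin> F j}"
    let ?W = "Inl ` (closure \<Omega> - ?P) \<union> Inr ` {G \<in> ends \<Omega> K. G j = F j}"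
    have "openin (end_topology \<Omega> K) ?W"
    proof (rule end_openI_openin)
      \<comment> \<open>\<open>?P\<close> is locally finite, because \<open>p\<close> meets each \<open>K m\<close> finitely often.\<close>
      have "\<exists>T. openin (top_of_set (closure \<Omega>)) T \<and> x \<in> T \<and> T \<subseteq> closure \<Omega> - ?P"
        if x: "x \<in> closure \<Omega> - ?P" for x
      proof -
        obtain U m where U: "open U" "x \<in> U" "U \<inter> closure \<Omega> \<subseteq> K m"
          using compact_exhaustion_local[OF ex, of x] x by blast
        have "p n \<notin> K m" if "m \<le> n" for n
          using p[of n] compact_exhaustion_mono[OF ex that] by blast
        then have sub: "?P \<inter> K m \<subseteq> p ` {..<m}"
          by (force simp: not_le)
        have "finite (?P \<inter> K m)"
          by (rule finite_subset[OF sub]) simp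
        then have "open (U - (?P \<inter> K m))"
          using U(1) finite_imp_closed open_Diff by blast
        then show ?thesis
          using U x by (intro exI[of _ "closure \<Omega> \<inter> (U - (?P \<inter> K m))"])
            (auto simp: openin_open)
      qed
      then show "openin (top_of_set (closure \<Omega>)) (closure \<Omega> - ?P)"
        by (subst openin_subopen) blast
      show "\<exists>i. end_nbhd \<Omega> K G i \<subseteq> ?W" if "G \<in> {G \<in> ends \<Omega> K. G j = F j}" for G
        using that end_mem_component(3)[of G \<Omega> K j]
        by (intro exI[of _ j]) (auto simp: end_nbhd_def)
    qed auto
    then show ?thesis
      by (rule eventually_mono[OF limitin_eventually[OF lim]]) (use F in auto)
  qed
  with F that show thesis
    by blast
qed

text \<open>
  Otherwise one can choose points \<open>p n\<close> outside \<open>K (n + j)\<close> in pairwise different components of the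
  complement of \<open>K j\<close>. A subsequence tends to an end \<open>F\<close>, and then two of its terms lie in the
  single component \<open>F j\<close>.
\<close>

lemma finitely_many_components_near_infinity:
  fixes \<Omega> :: "'a::t2_space set"
  assumes ex: "compact_exhaustion (closure \<Omega>) K"
    and sc: "sequentially_compact_space (end_topology \<Omega> K)"
  obtains i where "j \<le> i" "finite {D \<in> components (closure \<Omega> - K j). \<not> D \<subseteq> K i}"
proof (rule ccontr)
  let ?comp = "connected_component_set (closure \<Omega> - K j)"
  assume *: "\<not> thesis"
  have inf: "infinite {D \<in> components (closure \<Omega> - K j). \<not> D \<subseteq> K (n + j)}" for n
    using * that[of "n + j"] by auto
  define P where
    "P f n q \<longleftrightarrow> q \<in> closure \<Omega> - K (n + j) \<and> (\<forall>m<n. ?comp q \<noteq> ?comp (f m))" for f n q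
  have "\<exists>p. \<forall>n. P p n (p n)"
  proof (rule dependent_wf_choice[OF wf_less_than])
    fix n f
    have "\<not> {D \<in> components (closure \<Omega> - K j). \<not> D \<subseteq> K (n + j)} \<subseteq> (\<lambda>m. ?comp (f m)) ` {..<n}"
      using inf[of n] finite_surj by blast
    then obtain D where D: "D \<in> components (closure \<Omega> - K j)" "\<not> D \<subseteq> K (n + j)"
      "D \<notin> (\<lambda>m. ?comp (f m)) ` {..<n}"
      by blast
    then obtain q where q: "q \<in> D" "q \<notin> K (n + j)"
      by blast
    have "D = ?comp q"
      using D(1) q(1) by (metis componentsE connected_component_eq)
    then have "P f n q"
      using D q in_components_subset[OF D(1)] by (auto simp: P_def)
    then show "\<exists>q. P f n q" ..
  qed (auto simp: P_def)
  then obtain p where p: "\<And>n. p n \<in> closure \<Omega> - K (n + j)"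
    and new: "\<And>m n. m < n \<Longrightarrow> ?comp (p n) \<noteq> ?comp (p m)"
    by (auto simp: P_def)
  have "range (\<lambda>n. Inl (p n)) \<subseteq> topspace (end_topology \<Omega> K)"
    using p by (auto simp: topspace_end_topology)
  then obtain l r where r: "strict_mono r"
    and lim: "limitin (end_topology \<Omega> K) ((\<lambda>n. Inl (p n)) \<circ> r) l sequentially"
    using sc unfolding sequentially_compact_space_def by blast
  have "p (r n) \<in> closure \<Omega> - K n" for n
    using p[of "r n"] compact_exhaustion_mono[OF ex, of n "r n + j"] seq_suble[OF r, of n]
    by (simp add: subset_iff) (meson trans_le_add1)
  then obtain F where F: "F \<in> ends \<Omega> K" "\<And>j. \<forall>\<^sub>F n in sequentially. p (r n) \<in> F j"
    using escaping_limit_is_end[OF ex, of "\<lambda>n. p (r n)" l] lim unfolding o_def by blast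
  then obtain N where N: "\<And>n. n \<ge> N \<Longrightarrow> p (r n) \<in> F j"
    unfolding eventually_sequentially by blast
  have "?comp (p (r n)) = F j" if "n \<ge> N" for n
    using N[OF that] end_mem_component(1)[OF F(1), of j]
    by (metis componentsE connected_component_eq)
  then have "?comp (p (r (Suc N))) = ?comp (p (r N))"
    by simp
  then show False
    using new[of "r N" "r (Suc N)"] r by (simp add: strict_mono_less)
qed

text \<open>
  Components are closed in \<open>closure \<Omega> - K j\<close>. Outside \<open>K i\<close> only finitely many of them are left, so
  there each one is the complement of a finite union of closed sets.
\<close>

lemma component_open_near_infinity:
  fixes \<Omega> :: "'a::t2_space set"
  assumes ex: "compact_exhaustion (closure \<Omega>) K"
    and sc: "sequentially_compact_space (end_topology \<Omega> K)"
  obtains i where "j \<le> i"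
    "\<And>D. D \<in> components (closure \<Omega> - K j) \<Longrightarrow> openin (top_of_set (closure \<Omega>)) (D - K i)"
proof -
  let ?X = "closure \<Omega>"
  obtain i where i: "j \<le> i" "finite {D \<in> components (?X - K j). \<not> D \<subseteq> K i}"
    using finitely_many_components_near_infinity[OF ex sc] .
  have "openin (top_of_set ?X) (D - K i)" if D: "D \<in> components (?X - K j)" for D
  proof -
    define \<C> where "\<C> = {D \<in> components (?X - K j). \<not> D \<subseteq> K i} - {D}"
    have "x \<in> D" if x: "x \<in> ?X - K i" "x \<in> (?X - K j) - \<Union>\<C>" for x
    proof -
      have "x \<in> \<Union> (components (?X - K j))"
        using x(2) by simp
      then obtain E where E: "E \<in> components (?X - K j)" "x \<in> E"
        by (rule UnionE)
      have "\<not> E \<subseteq> K i" "E \<notin> \<C>"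
        using E(2) x by auto
      then show ?thesis
        using E by (simp add: \<C>_def)
    qed
    moreover have "D \<inter> E = {}" if "E \<in> \<C>" for E
      using components_nonoverlap[OF D, of E] that by (auto simp: \<C>_def)
    ultimately have "D - K i = (?X - K i) \<inter> ((?X - K j) - \<Union>\<C>)"
      using in_components_subset[OF D] by fast
    moreover have "openin (top_of_set (?X - K j)) ((?X - K j) - \<Union>\<C>)"
      by (rule openin_diff[OF openin_subtopology_self closedin_Union])
        (use i(2) closedin_component in \<open>auto simp: \<C>_def\<close>)
    then have "openin (top_of_set ?X) ((?X - K j) - \<Union>\<C>)"
      using openin_diff_exhaustion[OF ex] openin_trans by blast
    ultimately show ?thesis
      using openin_diff_exhaustion[OF ex, of i] by (simp add: openin_Int)
  qed
  with i(1) that show thesis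
    by blast
qed

text \<open>
  At an end \<open>F\<close> the sets \<open>end_nbhd \<Omega> K F j\<close> need not be open. Replacing \<open>F j\<close> by its open part
  \<open>F j - K (i j)\<close> makes them open, and they remain cofinal among the neighbourhoods of \<open>F\<close>.
\<close>

lemma first_countable_end_topology:
  fixes \<Omega> :: "'a::{t2_space,first_countable_topology} set"
  assumes ex: "compact_exhaustion (closure \<Omega>) K"
    and sc: "sequentially_compact_space (end_topology \<Omega> K)"
  shows "first_countable (end_topology \<Omega> K)"
  unfolding first_countable_def
proof
  fix x assume "x \<in> topspace (end_topology \<Omega> K)"
  then consider y where "y \<in> closure \<Omega>" "x = Inl y" | F where "F \<in> ends \<Omega> K" "x = Inr F"
    by (auto simp: topspace_end_topology)
  then show "\<exists>\<B>. countable \<B> \<and> (\<forall>V\<in>\<B>. openin (end_topology \<Omega> K) V) \<and>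
      (\<forall>U. openin (end_topology \<Omega> K) U \<and> x \<in> U \<longrightarrow> (\<exists>V\<in>\<B>. x \<in> V \<and> V \<subseteq> U))"
  proof cases
    case 1
    obtain \<A> where A: "countable \<A>" "\<And>A. A \<in> \<A> \<Longrightarrow> y \<in> A" "\<And>A. A \<in> \<A> \<Longrightarrow> open A"
      "\<And>S. open S \<Longrightarrow> y \<in> S \<Longrightarrow> \<exists>A\<in>\<A>. A \<subseteq> S"
      using first_countable_basisE[of y] by metis
    show ?thesis
    proof (intro exI[of _ "(\<lambda>A. Inl ` (closure \<Omega> \<inter> A)) ` \<A>"] conjI allI impI ballI)
      show "countable ((\<lambda>A. Inl ` (closure \<Omega> \<inter> A)) ` \<A>)"
        using A(1) by simp
      show "openin (end_topology \<Omega> K) V" if "V \<in> (\<lambda>A. Inl ` (closure \<Omega> \<inter> A)) ` \<A>" for V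
        using that A(3) by (auto intro!: openin_end_topology_Inl simp: openin_open)
    next
      fix U assume "openin (end_topology \<Omega> K) U \<and> x \<in> U"
      then obtain S where S: "open S" "y \<in> S" "Inl ` (S \<inter> closure \<Omega>) \<subseteq> U"
        using end_openD(2)[of \<Omega> K U y] 1 by (auto simp: openin_end_topology)
      then obtain B where "B \<in> \<A>" "B \<subseteq> S"
        using A(4) by blast
      then show "\<exists>V\<in>(\<lambda>A. Inl ` (closure \<Omega> \<inter> A)) ` \<A>. x \<in> V \<and> V \<subseteq> U"
        using A(2)[of B] S 1 by (intro bexI[of _ "Inl ` (closure \<Omega> \<inter> B)"]) auto
    qed
  next
    case 2
    have "\<exists>i\<ge>j. \<forall>D \<in> components (closure \<Omega> - K j).
        openin (top_of_set (closure \<Omega>)) (D - K i)" for j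
      using component_open_near_infinity[OF ex sc, of j] by metis
    then obtain i where i: "\<And>j. j \<le> i j"
      "\<And>j D. D \<in> components (closure \<Omega> - K j) \<Longrightarrow>
        openin (top_of_set (closure \<Omega>)) (D - K (i j))"
      by metis
    define V where "V j = Inl ` (F j - K (i j)) \<union> Inr ` {G \<in> ends \<Omega> K. G j = F j}" for j
    have V_open: "openin (end_topology \<Omega> K) (V j)" for j
      unfolding V_def
    proof (rule end_openI_openin)
      show "openin (top_of_set (closure \<Omega>)) (F j - K (i j))"
        using i(2) end_mem_component(1)[OF 2(1)] .
      fix G assume G: "G \<in> {G \<in> ends \<Omega> K. G j = F j}"
      then have "G (i j) \<subseteq> F j - K (i j)"
        using end_antimono[of G \<Omega> K, OF _ i(1)[of j]] end_mem_component(3)[of G \<Omega> K "i j"] by auto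
      moreover have "H j = F j" if "H (i j) = G (i j)" "H \<in> ends \<Omega> K" for H
        using end_determined_below[of G \<Omega> K H] G that i(1)[of j] by auto
      ultimately show "\<exists>k. end_nbhd \<Omega> K G k \<subseteq>
          Inl ` (F j - K (i j)) \<union> Inr ` {G \<in> ends \<Omega> K. G j = F j}"
        by (intro exI[of _ "i j"]) (auto simp: end_nbhd_def)
    qed auto
    have V_sub: "V j \<subseteq> end_nbhd \<Omega> K F j" for j
    proof -
      have "G \<nu> = F \<nu>" if "G \<in> ends \<Omega> K" "G j = F j" "\<nu> \<le> j" for G \<nu>
        by (rule end_determined_below[OF 2(1) that])
      then show ?thesis
        unfolding V_def end_nbhd_def by blast
    qed
    show ?thesis
    proof (intro exI[of _ "range V"] conjI allI impI ballI)
      fix U assume "openin (end_topology \<Omega> K) U \<and> x \<in> U"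
      then obtain j where "end_nbhd \<Omega> K F j \<subseteq> U"
        using end_openD(3)[of \<Omega> K U F] 2 by (auto simp: openin_end_topology)
      then show "\<exists>W\<in>range V. x \<in> W \<and> W \<subseteq> U"
        using V_sub[of j] 2 by (intro bexI[of _ "V j"]) (auto simp: V_def)
    qed (use V_open in auto)
  qed
qed

text \<open>
  A neighbourhood of an end contains a nonempty set \<open>F j\<close> of points of \<open>closure \<Omega>\<close>, together with
  neighbourhoods of these points, and so meets \<open>\<Omega>\<close>.
\<close>

lemma end_topology_closure_of:
  "end_topology \<Omega> K closure_of (Inl ` \<Omega>) = topspace (end_topology \<Omega> K)"
proof (rule dense_intersects_open[THEN iffD2], intro allI impI)
  fix U assume U: "openin (end_topology \<Omega> K) U \<and> U \<noteq> {}"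
  have "\<exists>y\<in>closure \<Omega>. Inl y \<in> U"
  proof -
    obtain x where x: "x \<in> U"
      using U by blast
    then consider y where "y \<in> closure \<Omega>" "x = Inl y" | F where "F \<in> ends \<Omega> K" "x = Inr F"
      using x U openin_subset[of "end_topology \<Omega> K" U] unfolding topspace_end_topology by blast
    then show ?thesis
    proof cases
      case 2
      then obtain j where "end_nbhd \<Omega> K F j \<subseteq> U"
        using end_openD(3)[of \<Omega> K U F] U x by (auto simp: openin_end_topology)
      then show ?thesis
        using end_mem_component(2,3)[OF 2(1), of j] by (fastforce simp: end_nbhd_def)
    qed (use x in auto)
  qed
  then obtain y where y: "y \<in> closure \<Omega>" "Inl y \<in> U"
    by blast
  obtain T where T: "open T" "y \<in> T" "Inl ` (T \<inter> closure \<Omega>) \<subseteq> U"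
    using end_openD(2)[of \<Omega> K U y] U y(2) by (auto simp: openin_end_topology)
  then have "T \<inter> \<Omega> \<noteq> {}"
    using open_Int_closure_eq_empty[of T \<Omega>] y(1) by blast
  then obtain w where "w \<in> T" "w \<in> \<Omega>"
    by blast
  then show "Inl ` \<Omega> \<inter> U \<noteq> {}"
    using T(3) closure_subset[of \<Omega>] by blast
qed

lemma first_countable_frequently_sequence:
  assumes "first_countable X" "x \<in> topspace X"
    and "\<exists>\<^sub>F w in atin_within X x S. P w"
  obtains \<sigma> where "\<And>n::nat. \<sigma> n \<in> S" "\<And>n. P (\<sigma> n)" "limitin X \<sigma> x sequentially"
proof -
  obtain \<B> where B: "countable \<B>" "\<And>V. V \<in> \<B> \<Longrightarrow> openin X V"
    "\<And>U. openin X U \<Longrightarrow> x \<in> U \<Longrightarrow> \<exists>V\<in>\<B>. x \<in> V \<and> V \<subseteq> U"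
    using assms(1,2) unfolding first_countable_def by meson
  define \<A> where "\<A> = {V\<in>\<B>. x \<in> V}"
  have A: "countable \<A>" "\<A> \<noteq> {}"
    using B(1) B(3)[of "topspace X"] assms(2) by (auto simp: \<A>_def)
  define V where "V n = (\<Inter>m\<le>n. from_nat_into \<A> m)" for n
  have "openin X (V n) \<and> x \<in> V n" for n
    using from_nat_into[OF A(2)] B(2) unfolding V_def \<A>_def
    by (auto intro!: openin_Inter)
  then have "\<exists>w\<in>V n. w \<in> S \<and> P w" for n
    using assms(2,3) unfolding frequently_def eventually_atin_within by blast
  then obtain \<sigma> where \<sigma>: "\<And>n. \<sigma> n \<in> V n" "\<And>n. \<sigma> n \<in> S" "\<And>n. P (\<sigma> n)"
    by metis
  have "limitin X \<sigma> x sequentially"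
    unfolding limitin_sequentially
  proof (intro conjI allI impI assms(2))
    fix U assume "openin X U \<and> x \<in> U"
    then obtain W where W: "W \<in> \<A>" "W \<subseteq> U"
      using B(3) by (auto simp: \<A>_def)
    then obtain m where "W = from_nat_into \<A> m"
      using from_nat_into_surj[OF A(1)] by metis
    then have "\<sigma> n \<in> U" if "m \<le> n" for n
      using \<sigma>(1)[of n] W(2) that by (auto simp: V_def)
    then show "\<exists>N. \<forall>n\<ge>N. \<sigma> n \<in> U"
      by blast
  qed
  with \<sigma> that show thesis
    by blast
qed

section \<open>Continuous functions modulo constants\<close>

lemma mod_const_class:
  "f \<in> cont_funs S \<Longrightarrow>
    mod_const S `` {f} = {g \<in> cont_funs S. \<exists>c. \<forall>x\<in>S. g x = f x + c}"
  by (auto simp: mod_const_def)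

text \<open>
  The difference \<open>f z - f a\<close> does not depend on the representative \<open>f\<close> of the class. These differences
  determine a class and are continuous on the quotient, so they serve as its coordinates.
\<close>

definition class_diff :: "('a \<Rightarrow> real) set \<Rightarrow> 'a \<Rightarrow> 'a \<Rightarrow> real" where
  "class_diff \<xi> a z = (let f = SOME f. f \<in> \<xi> in f z - f a)"

lemma class_diff_class:
  assumes "f \<in> cont_funs S" "a \<in> S" "z \<in> S"
  shows "class_diff (mod_const S `` {f}) a z = f z - f a"
proof -
  have "f \<in> mod_const S `` {f}"
    using assms(1) by (auto simp: mod_const_class intro: exI[of _ 0])
  then have "(SOME g. g \<in> mod_const S `` {f}) \<in> mod_const S `` {f}"
    by (rule someI[of "\<lambda>g. g \<in> mod_const S `` {f}" f])
  then obtain c where "\<forall>x\<in>S. (SOME g. g \<in> mod_const S `` {f}) x = f x + c"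
    using assms(1) by (auto simp: mod_const_class)
  then show ?thesis
    using assms(2,3) by (simp add: class_diff_def Let_def)
qed

lemma mod_const_class_eqI:
  assumes "f \<in> cont_funs S" "g \<in> cont_funs S" "\<And>z. z \<in> S \<Longrightarrow> f z - f a = g z - g a"
  shows "mod_const S `` {f} = mod_const S `` {g}"
proof -
  have "(\<exists>c. \<forall>x\<in>S. h x = f x + c) \<longleftrightarrow> (\<exists>c. \<forall>x\<in>S. h x = g x + c)" for h
  proof
    assume "\<exists>c. \<forall>x\<in>S. h x = f x + c"
    then obtain c where c: "\<forall>x\<in>S. h x = f x + c" ..
    have "h x = g x + (c + f a - g a)" if "x \<in> S" for x
      using c assms(3)[OF that] that by simp
    then show "\<exists>c. \<forall>x\<in>S. h x = g x + c"
      by blast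
  next
    assume "\<exists>c. \<forall>x\<in>S. h x = g x + c"
    then obtain c where c: "\<forall>x\<in>S. h x = g x + c" ..
    have "h x = f x + (c + g a - f a)" if "x \<in> S" for x
      using c assms(3)[OF that] that by simp
    then show "\<exists>c. \<forall>x\<in>S. h x = f x + c"
      by blast
  qed
  then show ?thesis
    using assms(1,2) by (simp add: mod_const_class)
qed

lemma continuous_map_class_diff:
  assumes "a \<in> S" "z \<in> S"
  shows "continuous_map (quot_topology S) euclideanreal (\<lambda>\<xi>. class_diff \<xi> a z)"
proof (rule continuous_compose_quotient_map[OF quotient_map_quot_topology])
  have "luc_open S {f \<in> cont_funs S. f z - f a \<in> U}" if U: "open U" for U
    unfolding luc_open_def
  proof (intro conjI ballI)
    fix f assume f: "f \<in> {f \<in> cont_funs S. f z - f a \<in> U}"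
    then obtain e where e: "e > 0" "ball (f z - f a) e \<subseteq> U"
      using U open_contains_ball by blast
    have "g z - g a \<in> U" if "\<bar>g z - f z\<bar> < e / 2" "\<bar>g a - f a\<bar> < e / 2" for g
    proof -
      have "g z - g a \<in> ball (f z - f a) e"
        using that unfolding mem_ball dist_real_def by linarith
      then show ?thesis
        using e(2) by blast
    qed
    then show "\<exists>C \<epsilon>. compact C \<and> C \<subseteq> S \<and> 0 < \<epsilon> \<and>
        {g \<in> cont_funs S. \<forall>x\<in>C. \<bar>g x - f x\<bar> < \<epsilon>} \<subseteq> {f \<in> cont_funs S. f z - f a \<in> U}"
      using assms e(1) by (intro exI[of _ "{z, a}"] exI[of _ "e / 2"]) auto
  qed auto
  then have "continuous_map (luc_topology S) euclideanreal (\<lambda>f. f z - f a)"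
    by (simp add: continuous_map_def topspace_luc_topology openin_luc_topology)
  then show "continuous_map (luc_topology S) euclideanreal
      ((\<lambda>\<xi>. class_diff \<xi> a z) \<circ> (\<lambda>f. mod_const S `` {f}))"
    by (rule continuous_map_eq)
      (simp add: topspace_luc_topology class_diff_class assms)
qed

lemma tendsto_class_diff:
  assumes "limitin (quot_topology S) s \<xi> F" "a \<in> S" "z \<in> S"
  shows "((\<lambda>i. class_diff (s i) a z) \<longlongrightarrow> class_diff \<xi> a z) F"
  using continuous_map_limit[OF continuous_map_class_diff[OF assms(2,3)] assms(1)]
  by (simp add: o_def)

lemma quot_limit_unique:
  assumes \<xi>: "limitin (quot_topology S) s \<xi> F" and \<eta>: "limitin (quot_topology S) s \<eta> F"
    and F: "F \<noteq> bot" and a: "a \<in> S"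
  shows "\<xi> = \<eta>"
proof -
  obtain f g where f: "f \<in> cont_funs S" "\<xi> = mod_const S `` {f}"
    and g: "g \<in> cont_funs S" "\<eta> = mod_const S `` {g}"
    using limitin_topspace[OF \<xi>] limitin_topspace[OF \<eta>]
    unfolding topspace_quot_topology quotient_def by blast
  have "f z - f a = g z - g a" if "z \<in> S" for z
    using tendsto_unique[OF F tendsto_class_diff[OF \<xi> a that] tendsto_class_diff[OF \<eta> a that]]
      f g a that by (simp add: class_diff_class)
  then show ?thesis
    using mod_const_class_eqI[OF f(1) g(1), of a] f(2) g(2) by simp
qed

section \<open>Horofunctions of an inner distance\<close>

text \<open>
  What the argument uses of the Kobayashi distance: it is a continuous metric on a locally compact
  space, and it is inner. The last assumption is the consequence of innerness that is needed: an
  almost shortest connection from \<open>w\<close> to \<open>p\<close> must cross the boundary of a neighbourhood of \<open>p\<close>.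
\<close>

locale inner_distance =
  fixes \<Omega> :: "'a::{t2_space,second_countable_topology} set" and d :: "'a \<Rightarrow> 'a \<Rightarrow> real"
  assumes open_domain: "open \<Omega>"
    and d_self: "x \<in> \<Omega> \<Longrightarrow> d x x = 0"
    and d_pos: "\<lbrakk>x \<in> \<Omega>; y \<in> \<Omega>; x \<noteq> y\<rbrakk> \<Longrightarrow> 0 < d x y"
    and d_commute: "\<lbrakk>x \<in> \<Omega>; y \<in> \<Omega>\<rbrakk> \<Longrightarrow> d x y = d y x"
    and d_triangle: "\<lbrakk>x \<in> \<Omega>; y \<in> \<Omega>; z \<in> \<Omega>\<rbrakk> \<Longrightarrow> d x z \<le> d x y + d y z"
    and d_small_near: "\<lbrakk>p \<in> \<Omega>; 0 < e\<rbrakk> \<Longrightarrow> \<exists>U. open U \<and> p \<in> U \<and> (\<forall>q\<in>U \<inter> \<Omega>. d p q < e)"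
    and compact_neighbourhood: "p \<in> \<Omega> \<Longrightarrow> \<exists>C. compact C \<and> C \<subseteq> \<Omega> \<and> p \<in> interior C"
    and crossing: "\<lbrakk>compact C; C \<subseteq> \<Omega>; p \<in> interior C; w \<in> \<Omega> - C; 0 < e\<rbrakk>
      \<Longrightarrow> \<exists>s\<in>frontier C. d w s + d s p \<le> d w p + e"
begin

definition nonexpansive :: "('a \<Rightarrow> real) set" where
  "nonexpansive = {f \<in> extensional \<Omega>. \<forall>y\<in>\<Omega>. \<forall>z\<in>\<Omega>. \<bar>f y - f z\<bar> \<le> d y z}"

definition embedding :: "'a \<Rightarrow> ('a \<Rightarrow> real) set" where
  "embedding x = mod_const \<Omega> `` {restrict (d x) \<Omega>}"

lemma d_nonneg: "\<lbrakk>x \<in> \<Omega>; y \<in> \<Omega>\<rbrakk> \<Longrightarrow> 0 \<le> d x y"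
  using d_pos[of x y] d_self[of x] by (cases "x = y") auto

lemma abs_d_diff_le:
  assumes "w \<in> \<Omega>" "y \<in> \<Omega>" "z \<in> \<Omega>"
  shows "\<bar>d w y - d w z\<bar> \<le> d y z"
  using d_triangle[of w y z] d_triangle[of w z y] d_commute[of y z] assms by simp

lemma nonexpansive_subset_cont_funs: "nonexpansive \<subseteq> cont_funs \<Omega>"
proof
  fix f assume f: "f \<in> nonexpansive"
  have "(f \<longlongrightarrow> f x) (at x within \<Omega>)" if x: "x \<in> \<Omega>" for x
  proof (rule tendstoI)
    fix e :: real assume "0 < e"
    then obtain U where U: "open U" "x \<in> U" "\<forall>q\<in>U \<inter> \<Omega>. d x q < e"
      using d_small_near[OF x] by blast
    have "dist (f y) (f x) < e" if "y \<in> U" "y \<in> \<Omega>" for y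
    proof -
      have "\<bar>f x - f y\<bar> \<le> d x y"
        using f x that by (simp add: nonexpansive_def)
      then show ?thesis
        using bspec[OF U(3), of y] that by (simp add: dist_real_def abs_minus_commute)
    qed
    then show "\<forall>\<^sub>F y in at x within \<Omega>. dist (f y) (f x) < e"
      using U by (auto simp: eventually_at_topological)
  qed
  then show "f \<in> cont_funs \<Omega>"
    using f by (auto simp: cont_funs_def nonexpansive_def continuous_on_def)
qed

lemma dist_diff_nonexpansive: "w \<in> \<Omega> \<Longrightarrow> restrict (\<lambda>z. d w z - c) \<Omega> \<in> nonexpansive"
  using abs_d_diff_le[of w] by (auto simp: nonexpansive_def)

lemma dist_nonexpansive: "w \<in> \<Omega> \<Longrightarrow> restrict (d w) \<Omega> \<in> nonexpansive"
  using dist_diff_nonexpansive[of w 0] by simp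

lemma dist_in_cont_funs: "w \<in> \<Omega> \<Longrightarrow> restrict (d w) \<Omega> \<in> cont_funs \<Omega>"
  using dist_nonexpansive nonexpansive_subset_cont_funs by blast

lemma embedding_eq_diff:
  assumes "w \<in> \<Omega>"
  shows "embedding w = mod_const \<Omega> `` {restrict (\<lambda>z. d w z - c) \<Omega>}"
  unfolding embedding_def
proof (rule mod_const_class_eqI[where a = w])
  show "restrict (d w) \<Omega> \<in> cont_funs \<Omega>" "restrict (\<lambda>z. d w z - c) \<Omega> \<in> cont_funs \<Omega>"
    using assms dist_in_cont_funs dist_diff_nonexpansive nonexpansive_subset_cont_funs by blast+
qed (simp add: assms)

lemma class_diff_embedding:
  assumes "w \<in> \<Omega>" "a \<in> \<Omega>" "z \<in> \<Omega>"
  shows "class_diff (embedding w) a z = d w z - d w a"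
  using class_diff_class[OF dist_in_cont_funs] assms by (simp add: embedding_def)

text \<open>
  A compact set is covered by finitely many small balls; equicontinuity transfers the estimate from
  the centres of the balls to all points.
\<close>

lemma nonexpansive_uniform_limit_on_compact:
  assumes f: "\<forall>\<^sub>F i in F. f i \<in> nonexpansive" and g: "g \<in> nonexpansive"
    and lim: "\<And>z. z \<in> \<Omega> \<Longrightarrow> ((\<lambda>i. f i z) \<longlongrightarrow> g z) F"
    and C: "compact C" "C \<subseteq> \<Omega>" and e: "0 < e"
  shows "\<forall>\<^sub>F i in F. \<forall>x\<in>C. \<bar>f i x - g x\<bar> < e"
proof -
  have "\<forall>c\<in>C. \<exists>U. open U \<and> c \<in> U \<and> (\<forall>q\<in>U \<inter> \<Omega>. d c q < e / 3)"
    using d_small_near[where e = "e / 3"] C(2) e by (meson subsetD zero_less_divide_iff zero_less_numeral)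
  then obtain U where U: "\<forall>c\<in>C. open (U c) \<and> c \<in> U c \<and> (\<forall>q\<in>U c \<inter> \<Omega>. d c q < e / 3)"
    by metis
  obtain T where T: "T \<subseteq> C" "finite T" "C \<subseteq> (\<Union>c\<in>T. U c)"
    by (rule compactE_image[OF C(1), of C U]) (use U in auto)
  have "\<forall>\<^sub>F i in F. \<bar>f i c - g c\<bar> < e / 3" if "c \<in> T" for c
    using tendstoD[OF lim, of c "e / 3"] that T(1) C(2) e by (auto simp: dist_real_def)
  then have "\<forall>\<^sub>F i in F. \<forall>c\<in>T. \<bar>f i c - g c\<bar> < e / 3"
    using T(2) by (simp add: eventually_ball_finite_distrib)
  with f show ?thesis
  proof eventually_elim
    case (elim i)
    show ?case
    proof
      fix x assume x: "x \<in> C"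
      then obtain c where c: "c \<in> T" "x \<in> U c"
        using T(3) by blast
      have in_\<Omega>: "c \<in> \<Omega>" "x \<in> \<Omega>"
        using c x T(1) C(2) by auto
      have "d c x < e / 3"
        using U c T(1) in_\<Omega> by blast
      moreover have "\<bar>f i c - f i x\<bar> \<le> d c x" "\<bar>g c - g x\<bar> \<le> d c x"
        using elim(1) g in_\<Omega> by (simp_all add: nonexpansive_def)
      moreover have "\<bar>f i c - g c\<bar> < e / 3"
        using elim(2) c by blast
      ultimately show "\<bar>f i x - g x\<bar> < e"
        by linarith
    qed
  qed
qed

lemma nonexpansive_limitin_luc:
  assumes "\<forall>\<^sub>F i in F. f i \<in> nonexpansive" "g \<in> nonexpansive"
    and "\<And>z. z \<in> \<Omega> \<Longrightarrow> ((\<lambda>i. f i z) \<longlongrightarrow> g z) F"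
  shows "limitin (luc_topology \<Omega>) f g F"
  unfolding limitin_def topspace_luc_topology openin_luc_topology
proof (intro conjI allI impI)
  show "g \<in> cont_funs \<Omega>"
    using assms(2) nonexpansive_subset_cont_funs by blast
  fix W assume "luc_open \<Omega> W \<and> g \<in> W"
  then obtain C e where C: "compact C" "C \<subseteq> \<Omega>" "0 < e"
    "{h \<in> cont_funs \<Omega>. \<forall>x\<in>C. \<bar>h x - g x\<bar> < e} \<subseteq> W"
    unfolding luc_open_def by meson
  have "\<forall>\<^sub>F i in F. \<forall>x\<in>C. \<bar>f i x - g x\<bar> < e"
    by (rule nonexpansive_uniform_limit_on_compact[OF assms(1,2) _ C(1-3)]) (rule assms(3))
  with assms(1) show "\<forall>\<^sub>F i in F. f i \<in> W"
    by eventually_elim (use C(4) nonexpansive_subset_cont_funs in blast)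
qed

lemma nonexpansive_limitin_quot:
  assumes "\<forall>\<^sub>F i in F. f i \<in> nonexpansive" "g \<in> nonexpansive"
    and "\<And>z. z \<in> \<Omega> \<Longrightarrow> ((\<lambda>i. f i z) \<longlongrightarrow> g z) F"
  shows "limitin (quot_topology \<Omega>) (\<lambda>i. mod_const \<Omega> `` {f i}) (mod_const \<Omega> `` {g}) F"
  using continuous_map_limit[OF quotient_imp_continuous_map[OF quotient_map_quot_topology]
      nonexpansive_limitin_luc[OF assms]]
  by (simp add: o_def)

text \<open>
  Suppose that the limit is \<open>embedding p\<close>, and let \<open>r\<close> be the distance from \<open>p\<close> to the boundary of a
  compact neighbourhood \<open>C\<close> of \<open>p\<close>. For large \<open>n\<close>, the difference \<open>d (\<sigma> n) s - d (\<sigma> n) p\<close> is close to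
  \<open>d p s\<close>, which is at least \<open>r\<close>, for all \<open>s\<close> in \<open>frontier C\<close>. But \<open>\<sigma> n\<close> is outside \<open>C\<close>, so at some
  such \<open>s\<close> an almost shortest connection from \<open>\<sigma> n\<close> to \<open>p\<close> enters \<open>C\<close>, and there the difference is
  at most \<open>- d s p\<close> up to a small error.
\<close>

lemma escaping_limit_not_in_image:
  assumes \<sigma>: "\<And>n. \<sigma> n \<in> \<Omega>" and lim: "limitin (quot_topology \<Omega>) (\<lambda>n. embedding (\<sigma> n)) \<xi> sequentially"
    and escape: "\<And>C. \<lbrakk>compact C; C \<subseteq> \<Omega>\<rbrakk> \<Longrightarrow> \<forall>\<^sub>F n in sequentially. \<sigma> n \<notin> C"
  shows "\<xi> \<notin> embedding ` \<Omega>"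
proof
  assume "\<xi> \<in> embedding ` \<Omega>"
  then obtain p where p: "p \<in> \<Omega>" "\<xi> = embedding p"
    by blast
  obtain C where C: "compact C" "C \<subseteq> \<Omega>" "p \<in> interior C"
    using compact_neighbourhood[OF p(1)] by blast
  have fr: "compact (frontier C)" "frontier C \<subseteq> \<Omega>" "p \<notin> frontier C"
    using C compact_imp_closed[OF C(1)] frontier_subset_closed[of C]
    by (auto intro!: compact_diff simp: frontier_def)
  have "\<exists>r>0. \<forall>s\<in>frontier C. r \<le> d p s"
  proof (cases "frontier C = {}")
    case False
    have "continuous_on (frontier C) (d p)"
      using dist_in_cont_funs[OF p(1)] continuous_on_subset[OF _ fr(2), of "d p"]
      by (simp add: cont_funs_def)
    then obtain s where s: "s \<in> frontier C" "\<forall>t\<in>frontier C. d p s \<le> d p t"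
      using continuous_attains_inf[OF fr(1) False] by blast
    moreover have "0 < d p s"
      using s fr p by (intro d_pos) auto
    ultimately show ?thesis
      by blast
  qed (auto intro: exI[of _ 1])
  then obtain r where r: "0 < r" "\<And>s. s \<in> frontier C \<Longrightarrow> r \<le> d p s"
    by blast
  have "\<forall>\<^sub>F n in sequentially. \<forall>s\<in>frontier C.
      \<bar>restrict (\<lambda>z. d (\<sigma> n) z - d (\<sigma> n) p) \<Omega> s - restrict (d p) \<Omega> s\<bar> < r"
  proof (rule nonexpansive_uniform_limit_on_compact[OF _ dist_nonexpansive[OF p(1)] _ fr(1,2) r(1)])
    fix z assume z: "z \<in> \<Omega>"
    show "(\<lambda>n. restrict (\<lambda>z. d (\<sigma> n) z - d (\<sigma> n) p) \<Omega> z) \<longlonglongrightarrow> restrict (d p) \<Omega> z"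
      using tendsto_class_diff[OF lim p(1) z] by (simp add: class_diff_embedding p \<sigma> z d_self)
  qed (intro always_eventually allI dist_diff_nonexpansive \<sigma>)
  with escape[OF C(1,2)] have "\<forall>\<^sub>F n in sequentially. False"
  proof eventually_elim
    case (elim n)
    obtain s where s: "s \<in> frontier C" "d (\<sigma> n) s + d s p \<le> d (\<sigma> n) p + r"
      using crossing[OF C, of "\<sigma> n" r] elim(1) \<sigma>[of n] r(1) by blast
    have "s \<in> \<Omega>"
      using s(1) fr(2) by blast
    moreover from this have "\<bar>d (\<sigma> n) s - d (\<sigma> n) p - d p s\<bar> < r"
      using bspec[OF elim(2) s(1)] by simp
    ultimately show False
      using s r(2)[of s] d_commute[of s p] p(1) by auto
  qed
  then show False
    by simp
qed

text \<open>
  The Arzela-Ascoli theorem for nonexpansive functions: convergence on a countable dense set, which a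
  diagonal argument provides, implies convergence everywhere.
\<close>

lemma nonexpansive_bounded_sequence_compact:
  assumes f: "\<And>n::nat. f n \<in> nonexpansive" and zero: "z0 \<in> \<Omega>" "\<And>n. f n z0 = 0"
  obtains r g where "strict_mono r" "g \<in> nonexpansive" "\<And>z. z \<in> \<Omega> \<Longrightarrow> (\<lambda>n. f (r n) z) \<longlonglongrightarrow> g z"
proof -
  obtain D :: "'a set" where D: "countable D" "\<And>U. open U \<Longrightarrow> U \<noteq> {} \<Longrightarrow> \<exists>x\<in>D. x \<in> U"
    using countable_dense_setE by blast
  have f_bound: "\<bar>f n x\<bar> \<le> d x z0" if "x \<in> \<Omega>" for n x
  proof -
    have "\<bar>f n x - f n z0\<bar> \<le> d x z0"
      using f[of n] that zero(1) by (simp add: nonexpansive_def)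
    then show ?thesis
      by (simp add: zero)
  qed
  \<comment> \<open>The diagonal argument is applied with one bound at all points, hence the weights.\<close>
  define u where "u n x = f n x / (1 + d x z0)" for n x
  have "norm (u n x) \<le> 1" if "x \<in> D \<inter> \<Omega>" for n x
    using f_bound[of x n] d_nonneg[of x z0] that zero(1) by (simp add: u_def)
  then obtain r where r: "strict_mono r" "\<And>x. x \<in> D \<inter> \<Omega> \<Longrightarrow> \<exists>l. (\<lambda>n. u (r n) x) \<longlonglongrightarrow> l"
    using function_convergent_subsequence[of "D \<inter> \<Omega>" u 1] D(1) by (metis countable_Int1)
  have conv: "convergent (\<lambda>n. f (r n) x)" if x: "x \<in> D \<inter> \<Omega>" for x
  proof -
    obtain l where "(\<lambda>n. u (r n) x) \<longlonglongrightarrow> l"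
      using r(2)[OF x] ..
    then have "(\<lambda>n. (1 + d x z0) * u (r n) x) \<longlonglongrightarrow> (1 + d x z0) * l"
      by (intro tendsto_intros)
    moreover have "(1 + d x z0) * u n x = f n x" for n
      using d_nonneg[of x z0] x zero(1) by (simp add: u_def)
    ultimately show ?thesis
      by (auto simp: convergent_def)
  qed
  have "convergent (\<lambda>n. f (r n) z)" if z: "z \<in> \<Omega>" for z
  proof (rule real_Cauchy_convergent, rule metric_CauchyI)
    fix e :: real assume e: "0 < e"
    then obtain U where U: "open U" "z \<in> U" "\<forall>q\<in>U \<inter> \<Omega>. d z q < e / 3"
      using d_small_near[OF z, of "e / 3"] by auto
    obtain c where c: "c \<in> D" "c \<in> U \<inter> \<Omega>"
      using D(2)[of "U \<inter> \<Omega>"] U(1,2) z open_domain by (auto simp: open_Int)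
    have "Cauchy (\<lambda>n. f (r n) c)"
      using conv c by (simp add: convergent_Cauchy)
    then obtain M where M: "\<And>m n. M \<le> m \<Longrightarrow> M \<le> n \<Longrightarrow> dist (f (r m) c) (f (r n) c) < e / 3"
      using metric_CauchyD[of _ "e / 3"] e by (metis zero_less_divide_iff zero_less_numeral)
    have close: "\<bar>f n z - f n c\<bar> < e / 3" for n
    proof -
      have "\<bar>f n z - f n c\<bar> \<le> d z c"
        using f[of n] z c by (simp add: nonexpansive_def)
      then show ?thesis
        using bspec[OF U(3) c(2)] by linarith
    qed
    have "dist (f (r m) z) (f (r n) z) < e" if "M \<le> m" "M \<le> n" for m n
      using M[OF that] close[of "r m"] close[of "r n"] unfolding dist_real_def by linarith
    then show "\<exists>M. \<forall>m\<ge>M. \<forall>n\<ge>M. dist (f (r m) z) (f (r n) z) < e"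
      by blast
  qed
  then have g: "(\<lambda>n. f (r n) z) \<longlonglongrightarrow> restrict (\<lambda>z. lim (\<lambda>n. f (r n) z)) \<Omega> z" if "z \<in> \<Omega>" for z
    using that by (simp add: convergent_LIMSEQ_iff)
  have "\<bar>restrict (\<lambda>z. lim (\<lambda>n. f (r n) z)) \<Omega> y - restrict (\<lambda>z. lim (\<lambda>n. f (r n) z)) \<Omega> z\<bar> \<le> d y z"
    if "y \<in> \<Omega>" "z \<in> \<Omega>" for y z
  proof (rule tendsto_upperbound)
    show "(\<lambda>n. \<bar>f (r n) y - f (r n) z\<bar>) \<longlonglongrightarrow>
        \<bar>restrict (\<lambda>z. lim (\<lambda>n. f (r n) z)) \<Omega> y - restrict (\<lambda>z. lim (\<lambda>n. f (r n) z)) \<Omega> z\<bar>"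
      using g[OF that(1)] g[OF that(2)] by (intro tendsto_intros)
    show "\<forall>\<^sub>F n in sequentially. \<bar>f (r n) y - f (r n) z\<bar> \<le> d y z"
      using f that by (simp add: nonexpansive_def)
  qed simp
  then have "restrict (\<lambda>z. lim (\<lambda>n. f (r n) z)) \<Omega> \<in> nonexpansive"
    by (auto simp: nonexpansive_def)
  from that[OF r(1) this g] show thesis .
qed

end

section \<open>Extension to the end compactification\<close>

locale inner_distance_ends = inner_distance +
  fixes K :: "nat \<Rightarrow> 'a set" and z0 :: 'a
  assumes exhaustion: "compact_exhaustion (closure \<Omega>) K"
    and seq_compact: "sequentially_compact_space (end_topology \<Omega> K)"
    and base_point: "z0 \<in> \<Omega>"
begin

abbreviation X :: "('a + (nat \<Rightarrow> 'a set)) topology" where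
  "X \<equiv> end_topology \<Omega> K"

text \<open>
  The set \<open>\<H>(x)\<close> for an arbitrary inner distance.
\<close>

definition boundary_limits :: "'a + (nat \<Rightarrow> 'a set) \<Rightarrow> ('a \<Rightarrow> real) set set" where
  "boundary_limits x = {\<xi> \<in> quot_topology \<Omega> closure_of embedding ` \<Omega> - embedding ` \<Omega>.
     \<exists>\<sigma>::nat \<Rightarrow> 'a. range \<sigma> \<subseteq> \<Omega> \<and> limitin X (\<lambda>n. Inl (\<sigma> n)) x sequentially \<and>
       limitin (quot_topology \<Omega>) (\<lambda>n. embedding (\<sigma> n)) \<xi> sequentially}"

lemma approaching_sequence:
  assumes x: "x \<in> end_boundary \<Omega> K" and P: "\<exists>\<^sub>F w in atin_within X x (Inl ` \<Omega>). P w"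
  obtains \<sigma> where "\<And>n::nat. \<sigma> n \<in> \<Omega>" "\<And>n. P (Inl (\<sigma> n))"
    "limitin X (\<lambda>n. Inl (\<sigma> n)) x sequentially"
proof -
  have "x \<in> topspace X"
    using x by (simp add: end_boundary_def)
  then obtain \<tau> where \<tau>: "\<And>n::nat. \<tau> n \<in> Inl ` \<Omega>" "\<And>n. P (\<tau> n)" "limitin X \<tau> x sequentially"
    by (rule first_countable_frequently_sequence
        [OF first_countable_end_topology[OF exhaustion seq_compact] _ P]) (rule that; assumption)
  have \<tau>_eq: "\<tau> n = Inl (projl (\<tau> n))" "projl (\<tau> n) \<in> \<Omega>" for n
    using \<tau>(1)[of n] by auto
  show thesis
    by (rule that[of "\<lambda>n. projl (\<tau> n)"]) (use \<tau> \<tau>_eq in \<open>simp_all flip: \<tau>_eq(1)\<close>)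
qed

lemma boundary_not_isolated:
  assumes "x \<in> end_boundary \<Omega> K"
  shows "atin_within X x (Inl ` \<Omega>) \<noteq> bot"
proof -
  have "x \<in> X derived_set_of (Inl ` \<Omega>)"
    using assms end_topology_closure_of[of \<Omega> K] closure_of[of X "Inl ` \<Omega>"]
    unfolding end_boundary_def by blast
  then show ?thesis
    by (simp add: derived_set_of_trivial_limit)
qed

lemma boundary_sequence_escapes:
  assumes x: "x \<in> end_boundary \<Omega> K" and lim: "limitin X (\<lambda>n. Inl (\<sigma> n)) x sequentially"
    and C: "compact C" "C \<subseteq> \<Omega>"
  shows "\<forall>\<^sub>F n in sequentially. \<sigma> n \<notin> C"
proof -
  have op: "openin X (Inl ` (closure \<Omega> - C) \<union> Inr ` ends \<Omega> K)"
    using C closure_subset by (intro openin_end_compl_compact[OF exhaustion]) auto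
  show ?thesis
    by (rule eventually_mono[OF limitin_eventually[OF lim op]])
      (use x C(2) in \<open>auto simp: end_boundary_def topspace_end_topology\<close>)
qed

lemma boundary_limit_not_in_image:
  assumes "x \<in> end_boundary \<Omega> K" "\<And>n. \<sigma> n \<in> \<Omega>"
    and "limitin X (\<lambda>n. Inl (\<sigma> n)) x sequentially"
    and "limitin (quot_topology \<Omega>) (\<lambda>n. embedding (\<sigma> n)) \<xi> sequentially"
  shows "\<xi> \<notin> embedding ` \<Omega>"
  using escaping_limit_not_in_image[of \<sigma> \<xi>] boundary_sequence_escapes[of x \<sigma>] assms by blast

lemma continuous_map_on_domain:
  assumes "continuous_on \<Omega> f"
  shows "continuous_map (subtopology X (Inl ` \<Omega>)) euclideanreal (\<lambda>w. f (projl w))"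
  unfolding continuous_map_def
proof (intro conjI allI impI)
  fix U :: "real set" assume "openin euclideanreal U"
  then have "open (f -` U \<inter> \<Omega>)"
    using continuous_on_open_vimage[OF open_domain, of f] assms by simp
  moreover have "f -` U \<inter> \<Omega> = {w \<in> \<Omega>. f w \<in> U}"
    by auto
  ultimately have "openin X (Inl ` {w \<in> \<Omega>. f w \<in> U})"
    using closure_subset by (intro openin_end_topology_Inl_open) auto
  moreover have "{w \<in> topspace (subtopology X (Inl ` \<Omega>)). f (projl w) \<in> U} =
      Inl ` {w \<in> \<Omega>. f w \<in> U} \<inter> Inl ` \<Omega>"
    using closure_subset[of \<Omega>] by (auto simp: topspace_end_topology)
  ultimately show "openin (subtopology X (Inl ` \<Omega>))
      {w \<in> topspace (subtopology X (Inl ` \<Omega>)). f (projl w) \<in> U}"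
    by (auto simp: openin_subtopology)
qed simp

text \<open>
  For fixed \<open>z\<close> the real function \<open>w \<mapsto> d z w - d z0 w\<close> extends continuously to a function \<open>g z\<close>.
  For fixed \<open>x\<close> the function \<open>z \<mapsto> g z x\<close> is nonexpansive, because this is a closed condition on \<open>x\<close>
  that holds on the dense subset \<open>\<Omega>\<close>. Since nonexpansive functions converge locally uniformly as
  soon as they converge pointwise, the continuity of every \<open>g z\<close> gives continuity into the
  quotient.
\<close>

lemma extension_of_limits:
  assumes lim: "\<forall>x\<in>end_boundary \<Omega> K. \<forall>z\<in>\<Omega>. \<exists>L::real.
    ((\<lambda>w. d z (projl w) - d z0 (projl w)) \<longlongrightarrow> L) (atin_within X x (Inl ` \<Omega>))"
  shows "\<exists>G. continuous_map X
      (subtopology (quot_topology \<Omega>) (quot_topology \<Omega> closure_of embedding ` \<Omega>)) G \<and>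
      (\<forall>w\<in>\<Omega>. G (Inl w) = embedding w)"
proof -
  have "\<exists>g. continuous_map X euclideanreal g \<and>
      (\<forall>w\<in>\<Omega>. g (Inl w) = d z w - d z0 w)" if z: "z \<in> \<Omega>" for z
  proof -
    let ?f = "\<lambda>w :: 'a + (nat \<Rightarrow> 'a set). d z (projl w) - d z0 (projl w)"
    have "continuous_on \<Omega> (\<lambda>w. d z w - d z0 w)"
      using dist_in_cont_funs[OF z] dist_in_cont_funs[OF base_point]
      by (intro continuous_intros) (simp_all add: cont_funs_def)
    then have cont: "continuous_map (subtopology X (Inl ` \<Omega>)) euclideanreal ?f"
      by (rule continuous_map_on_domain)
    have sub: "Inl ` \<Omega> \<subseteq> topspace X"
      using closure_subset[of \<Omega>] by (auto simp: topspace_end_topology)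
    have ex: "\<exists>l. limitin euclideanreal ?f l (atin_within X t (Inl ` \<Omega>))"
      if "t \<in> topspace X - Inl ` \<Omega>" for t
      using lim that z by (simp add: end_boundary_def)
    obtain g where "continuous_map (subtopology X (topspace X)) euclideanreal g"
      "\<And>w. w \<in> Inl ` \<Omega> \<Longrightarrow> g w = ?f w"
      using continuous_map_extension_pointwise_alt
        [OF regular_space_euclidean sub _ cont ex] end_topology_closure_of[of \<Omega> K] by auto
    then show ?thesis
      by (intro exI[of _ g]) simp
  qed
  then obtain g where g: "\<And>z. z \<in> \<Omega> \<Longrightarrow> continuous_map X euclideanreal (g z)"
    "\<And>z w. z \<in> \<Omega> \<Longrightarrow> w \<in> \<Omega> \<Longrightarrow> g z (Inl w) = d z w - d z0 w"
    by metis
  define E where "E x = restrict (\<lambda>z. g z x) \<Omega>" for x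
  have E_Inl: "E (Inl w) = restrict (\<lambda>z. d w z - d w z0) \<Omega>" if "w \<in> \<Omega>" for w
    using g(2) that d_commute base_point by (auto simp: E_def)
  have E_nonexpansive: "E x \<in> nonexpansive" if x: "x \<in> topspace X" for x
  proof -
    have "\<bar>g y x - g z x\<bar> \<le> d y z" if yz: "y \<in> \<Omega>" "z \<in> \<Omega>" for y z
    proof -
      have cont: "continuous_map X euclideanreal (\<lambda>x. \<bar>g y x - g z x\<bar>)"
        by (intro continuous_intros g yz)
      have "closedin X {x \<in> topspace X. \<bar>g y x - g z x\<bar> \<in> {..d y z}}"
        by (rule closedin_continuous_map_preimage[OF cont]) simp
      moreover have "Inl ` \<Omega> \<subseteq> {x \<in> topspace X. \<bar>g y x - g z x\<bar> \<in> {..d y z}}"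
      proof (rule image_subsetI)
        fix w assume w: "w \<in> \<Omega>"
        then show "Inl w \<in> {x \<in> topspace X. \<bar>g y x - g z x\<bar> \<in> {..d y z}}"
          using abs_d_diff_le[OF w yz] g(2) yz d_commute[OF w] closure_subset[of \<Omega>]
          by (auto simp: topspace_end_topology)
      qed
      ultimately have "X closure_of (Inl ` \<Omega>) \<subseteq> {x \<in> topspace X. \<bar>g y x - g z x\<bar> \<in> {..d y z}}"
        by (rule closure_of_minimal[rotated])
      then show ?thesis
        using x unfolding end_topology_closure_of by auto
    qed
    then show ?thesis
      by (simp add: nonexpansive_def E_def)
  qed
  define G where "G x = mod_const \<Omega> `` {E x}" for x
  have G_Inl: "G (Inl w) = embedding w" if "w \<in> \<Omega>" for w
    using that by (simp add: G_def E_Inl embedding_eq_diff[OF that, of "d w z0"])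
  have G_cont: "continuous_map X (quot_topology \<Omega>) G"
    unfolding continuous_map_atin G_def
  proof
    fix x assume x: "x \<in> topspace X"
    show "limitin (quot_topology \<Omega>) (\<lambda>x. mod_const \<Omega> `` {E x}) (mod_const \<Omega> `` {E x}) (atin X x)"
    proof (rule nonexpansive_limitin_quot[OF _ E_nonexpansive[OF x]])
      show "\<forall>\<^sub>F y in atin X x. E y \<in> nonexpansive"
        using x E_nonexpansive by (auto simp: eventually_atin_within intro!: exI[of _ "topspace X"])
      show "((\<lambda>y. E y z) \<longlongrightarrow> E x z) (atin X x)" if "z \<in> \<Omega>" for z
        using limitin_continuous_map[OF g(1)[OF that] x refl] that by (simp add: E_def)
    qed
  qed
  have "G ` topspace X \<subseteq> quot_topology \<Omega> closure_of (G ` Inl ` \<Omega>)"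
    using continuous_map_image_closure_subset[OF G_cont, of "Inl ` \<Omega>"]
    unfolding end_topology_closure_of .
  also have "G ` Inl ` \<Omega> = embedding ` \<Omega>"
    using G_Inl by (force simp: image_image)
  finally have "continuous_map X
      (subtopology (quot_topology \<Omega>) (quot_topology \<Omega> closure_of embedding ` \<Omega>)) G"
    using G_cont by (simp add: continuous_map_in_subtopology image_subset_iff)
  then show ?thesis
    using G_Inl by blast
qed

text \<open>
  Continuity identifies \<open>G x\<close> as the only possible limit. That \<open>G x\<close> is attained uses that \<open>\<Omega>\<close> is
  dense and the compactification first countable; that it is outside the image uses innerness.
\<close>

lemma boundary_limits_of_extension:
  assumes G: "continuous_map X
      (subtopology (quot_topology \<Omega>) (quot_topology \<Omega> closure_of embedding ` \<Omega>)) G"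
    and G_Inl: "\<forall>w\<in>\<Omega>. G (Inl w) = embedding w"
    and x: "x \<in> end_boundary \<Omega> K"
  shows "boundary_limits x = {G x}"
proof -
  have G_lim: "limitin (quot_topology \<Omega>) (\<lambda>n. embedding (\<sigma> n)) (G x) sequentially"
    if "\<And>n. \<sigma> n \<in> \<Omega>" "limitin X (\<lambda>n. Inl (\<sigma> n)) x sequentially" for \<sigma> :: "nat \<Rightarrow> 'a"
    using continuous_map_limit[OF G that(2)] G_Inl that(1)
    by (simp add: o_def limitin_subtopology)
  have "G x \<in> boundary_limits x"
  proof -
    have "\<exists>\<^sub>F w in atin_within X x (Inl ` \<Omega>). True"
      using boundary_not_isolated[OF x] by (simp add: frequently_const)
    then obtain \<sigma> where \<sigma>: "\<And>n::nat. \<sigma> n \<in> \<Omega>" "limitin X (\<lambda>n. Inl (\<sigma> n)) x sequentially"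
      by (rule approaching_sequence[OF x]) (rule that; assumption)
    have "G x \<in> quot_topology \<Omega> closure_of embedding ` \<Omega>"
      using G x by (auto simp: continuous_map_in_subtopology end_boundary_def)
    moreover have "G x \<notin> embedding ` \<Omega>"
      by (rule boundary_limit_not_in_image[OF x \<sigma> G_lim[OF \<sigma>]])
    ultimately show ?thesis
      using \<sigma> G_lim[OF \<sigma>] unfolding boundary_limits_def by blast
  qed
  moreover have "\<xi> = G x" if \<xi>: "\<xi> \<in> boundary_limits x" for \<xi>
  proof -
    obtain \<sigma> :: "nat \<Rightarrow> 'a" where "range \<sigma> \<subseteq> \<Omega>" "limitin X (\<lambda>n. Inl (\<sigma> n)) x sequentially"
      "limitin (quot_topology \<Omega>) (\<lambda>n. embedding (\<sigma> n)) \<xi> sequentially"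
      using \<xi> unfolding boundary_limits_def by blast
    then show ?thesis
      using G_lim[of \<sigma>] quot_limit_unique[OF _ _ sequentially_bot base_point] by blast
  qed
  ultimately show ?thesis
    by blast
qed

lemma convergent_subsequence_to_boundary_limit:
  assumes x: "x \<in> end_boundary \<Omega> K" and \<sigma>: "\<And>n. \<sigma> n \<in> \<Omega>"
    and lim: "limitin X (\<lambda>n. Inl (\<sigma> n)) x sequentially"
  obtains r \<xi> where "strict_mono r" "\<xi> \<in> boundary_limits x"
    "limitin (quot_topology \<Omega>) (\<lambda>n. embedding (\<sigma> (r n))) \<xi> sequentially"
proof -
  obtain r g where r: "strict_mono r" and g: "g \<in> nonexpansive"
    and conv: "\<And>z. z \<in> \<Omega> \<Longrightarrow>
      (\<lambda>n. restrict (\<lambda>z. d (\<sigma> (r n)) z - d (\<sigma> (r n)) z0) \<Omega> z) \<longlonglongrightarrow> g z"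
  proof (rule nonexpansive_bounded_sequence_compact
      [of "\<lambda>n. restrict (\<lambda>z. d (\<sigma> n) z - d (\<sigma> n) z0) \<Omega>", OF _ base_point])
    show "restrict (\<lambda>z. d (\<sigma> n) z - d (\<sigma> n) z0) \<Omega> \<in> nonexpansive" for n
      by (rule dist_diff_nonexpansive[OF \<sigma>])
  qed (use base_point in auto)
  let ?\<xi> = "mod_const \<Omega> `` {g}"
  have "limitin (quot_topology \<Omega>)
      (\<lambda>n. mod_const \<Omega> `` {restrict (\<lambda>z. d (\<sigma> (r n)) z - d (\<sigma> (r n)) z0) \<Omega>}) ?\<xi> sequentially"
    by (rule nonexpansive_limitin_quot[OF _ g conv]) (intro always_eventually allI dist_diff_nonexpansive \<sigma>)
  then have embedding_lim: "limitin (quot_topology \<Omega>) (\<lambda>n. embedding (\<sigma> (r n))) ?\<xi> sequentially"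
    by (simp flip: embedding_eq_diff add: \<sigma>)
  have r_lim: "limitin X (\<lambda>n. Inl (\<sigma> (r n))) x sequentially"
    using limitin_subsequence[OF r lim] by (simp add: o_def)
  have "?\<xi> \<notin> embedding ` \<Omega>"
    by (rule boundary_limit_not_in_image[OF x _ r_lim embedding_lim]) (rule \<sigma>)
  moreover have "?\<xi> \<in> quot_topology \<Omega> closure_of embedding ` \<Omega>"
    unfolding in_closure_of
  proof (intro conjI allI impI)
    show "?\<xi> \<in> topspace (quot_topology \<Omega>)"
      by (rule limitin_topspace[OF embedding_lim])
    fix T assume "?\<xi> \<in> T \<and> openin (quot_topology \<Omega>) T"
    then have "\<forall>\<^sub>F n in sequentially. embedding (\<sigma> (r n)) \<in> T"
      using limitin_eventually[OF embedding_lim] by blast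
    then have "\<exists>n. embedding (\<sigma> (r n)) \<in> T"
      by (auto simp: eventually_sequentially)
    then show "\<exists>y. y \<in> embedding ` \<Omega> \<and> y \<in> T"
      using \<sigma> by blast
  qed
  ultimately have "?\<xi> \<in> boundary_limits x"
    using \<sigma> r_lim embedding_lim unfolding boundary_limits_def
    by (intro CollectI conjI DiffI exI[of _ "\<lambda>n. \<sigma> (r n)"]) auto
  then show thesis
    using that[OF r _ embedding_lim] by simp
qed

text \<open>
  If the limit failed, some sequence tending to \<open>x\<close> would keep the differences away from the value
  prescribed by \<open>\<xi>\<close>. But a subsequence tends to an element of \<open>boundary_limits x\<close>, that is, to \<open>\<xi>\<close>.
\<close>

lemma limit_of_unique_boundary_limit:
  assumes x: "x \<in> end_boundary \<Omega> K" and single: "boundary_limits x = {\<xi>}" and z: "z \<in> \<Omega>"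
  shows "((\<lambda>w. d z (projl w) - d z0 (projl w)) \<longlongrightarrow> class_diff \<xi> z0 z)
    (atin_within X x (Inl ` \<Omega>))"
proof (rule ccontr)
  let ?L = "class_diff \<xi> z0 z"
  assume "\<not> ?thesis"
  then obtain e where e: "0 < e" and
    "\<exists>\<^sub>F w in atin_within X x (Inl ` \<Omega>). \<not> dist (d z (projl w) - d z0 (projl w)) ?L < e"
    unfolding tendsto_iff frequently_def by auto
  then obtain \<sigma> where \<sigma>: "\<And>n::nat. \<sigma> n \<in> \<Omega>"
    "\<And>n. \<not> dist (d z (projl (Inl (\<sigma> n) :: 'a + (nat \<Rightarrow> 'a set))) - d z0 (projl (Inl (\<sigma> n) :: 'a + (nat \<Rightarrow> 'a set)))) ?L < e"
    "limitin X (\<lambda>n. Inl (\<sigma> n)) x sequentially"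
    by - (rule approaching_sequence[OF x], assumption, rule that; assumption)
  obtain r \<eta> where "\<eta> \<in> boundary_limits x"
    and lim: "limitin (quot_topology \<Omega>) (\<lambda>n. embedding (\<sigma> (r n))) \<eta> sequentially"
    by (rule convergent_subsequence_to_boundary_limit[OF x \<sigma>(1,3)])
  then have "\<eta> = \<xi>"
    using single by blast
  then have "\<forall>\<^sub>F n in sequentially. dist (class_diff (embedding (\<sigma> (r n))) z0 z) ?L < e"
    using tendstoD[OF tendsto_class_diff[OF lim base_point z] e] by simp
  then obtain n where "dist (class_diff (embedding (\<sigma> (r n))) z0 z) ?L < e"
    by (auto simp: eventually_sequentially)
  then show False
    using \<sigma>(2)[of "r n"] \<sigma>(1) d_commute[of "\<sigma> (r n)"] z base_point by (simp add: class_diff_embedding)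
qed

theorem limits_iff_singleton_iff_extension:
  "((\<forall>x\<in>end_boundary \<Omega> K. \<forall>z\<in>\<Omega>. \<exists>L::real.
        ((\<lambda>w. d z (projl w) - d z0 (projl w)) \<longlongrightarrow> L) (atin_within X x (Inl ` \<Omega>)))
    \<longleftrightarrow> (\<forall>x\<in>end_boundary \<Omega> K. is_singleton (boundary_limits x)))
   \<and> ((\<forall>x\<in>end_boundary \<Omega> K. is_singleton (boundary_limits x))
    \<longleftrightarrow> (\<exists>G. continuous_map X
          (subtopology (quot_topology \<Omega>) (quot_topology \<Omega> closure_of embedding ` \<Omega>)) G \<and>
        (\<forall>w\<in>\<Omega>. G (Inl w) = embedding w)))"
  (is "(?lim \<longleftrightarrow> ?single) \<and> (_ \<longleftrightarrow> ?ext)")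
proof -
  have "?lim \<Longrightarrow> ?ext"
    by (rule extension_of_limits)
  moreover have "?single" if ext: "?ext"
  proof -
    obtain G where G: "continuous_map X
        (subtopology (quot_topology \<Omega>) (quot_topology \<Omega> closure_of embedding ` \<Omega>)) G"
      "\<forall>w\<in>\<Omega>. G (Inl w) = embedding w"
      using ext by blast
    show ?single
      by (simp add: boundary_limits_of_extension[OF G])
  qed
  moreover have "?lim" if single: "?single"
  proof (intro ballI)
    fix x z assume x: "x \<in> end_boundary \<Omega> K" and z: "z \<in> \<Omega>"
    obtain \<xi> where "boundary_limits x = {\<xi>}"
      using bspec[OF single x] by (rule is_singletonE)
    from limit_of_unique_boundary_limit[OF x this z] show "\<exists>L::real.
        ((\<lambda>w. d z (projl w) - d z0 (projl w)) \<longlongrightarrow> L) (atin_within X x (Inl ` \<Omega>))"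
      by (rule exI)
  qed
  ultimately show ?thesis
    by argo
qed

end

section \<open>The Kobayashi distance is inner\<close>

abbreviation chain_length :: "((complex \<Rightarrow> 'a) \<times> complex \<times> complex) list \<Rightarrow> real" where
  "chain_length cs \<equiv> (\<Sum>(f, a, b)\<leftarrow>cs. poincare_dist a b)"

lemma poincare_dist_Moebius: "poincare_dist a b = artanh (cmod (Moebius_function 0 b a))"
  by (simp add: poincare_dist_def Moebius_function_simple)

lemma poincare_dist_nonneg:
  assumes "a \<in> ball 0 1" "b \<in> ball 0 1"
  shows "0 \<le> poincare_dist a b"
proof -
  define m where "m = cmod (Moebius_function 0 b a)"
  have "0 \<le> m" "m < 1"
    using assms by (simp_all add: m_def Moebius_function_norm_lt_1)
  then have "0 \<le> artanh m"
    by (simp add: artanh_def)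
  then show ?thesis
    by (simp add: poincare_dist_Moebius m_def)
qed

lemma chain_length_nonneg: "disc_chain A \<Omega> z cs w \<Longrightarrow> 0 \<le> chain_length cs"
proof (induction cs arbitrary: z)
  case (Cons x cs)
  obtain f a b where x: "x = (f, a, b)"
    by (metis surj_pair)
  show ?case
    using Cons.IH[of "f b"] Cons.prems poincare_dist_nonneg[of a b] unfolding x by auto
qed simp

lemma kobayashi_dist_le:
  assumes "disc_chain A \<Omega> z cs w"
  shows "kobayashi_dist A \<Omega> z w \<le> chain_length cs"
  unfolding kobayashi_dist_def
proof (rule cInf_lower)
  show "bdd_below {chain_length cs |cs. disc_chain A \<Omega> z cs w}"
    using chain_length_nonneg by (intro bdd_belowI[of _ 0]) auto
qed (use assms in blast)

lemma kobayashi_dist_approx: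
  assumes "\<exists>cs. disc_chain A \<Omega> z cs w" "0 < e"
  obtains cs where "disc_chain A \<Omega> z cs w" "chain_length cs < kobayashi_dist A \<Omega> z w + e"
proof -
  have "Inf {chain_length cs |cs. disc_chain A \<Omega> z cs w} < kobayashi_dist A \<Omega> z w + e"
    using assms(2) by (simp add: kobayashi_dist_def)
  then have "\<exists>x\<in>{chain_length cs |cs. disc_chain A \<Omega> z cs w}. x < kobayashi_dist A \<Omega> z w + e"
    using assms(1) by (intro cInf_lessD) auto
  then show thesis
    using that by blast
qed

lemma disc_chain_append:
  "disc_chain A \<Omega> z cs u \<Longrightarrow> disc_chain A \<Omega> u ds w \<Longrightarrow> disc_chain A \<Omega> z (cs @ ds) w"
proof (induction cs arbitrary: z)
  case (Cons x cs)
  obtain f a b where x: "x = (f, a, b)"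
    by (metis surj_pair)
  show ?case
    using Cons unfolding x by auto
qed simp

lemma holomorphic_discs_compose:
  assumes f: "f \<in> holomorphic_discs A \<Omega>"
    and g: "g holomorphic_on ball 0 1" "g ` ball 0 1 \<subseteq> ball 0 1"
  shows "f \<circ> g \<in> holomorphic_discs A \<Omega>"
  unfolding holomorphic_discs_def
proof (intro CollectI conjI)
  have f': "f ` ball 0 1 \<subseteq> \<Omega>" "continuous_on (ball 0 1) f"
    "\<And>U \<phi> i. (U, \<phi>) \<in> A \<Longrightarrow> (\<lambda>\<zeta>. \<phi> (f \<zeta>) $ i) holomorphic_on {\<zeta> \<in> ball 0 1. f \<zeta> \<in> U}"
    using f unfolding holomorphic_discs_def by blast+
  show "(f \<circ> g) ` ball 0 1 \<subseteq> \<Omega>"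
    using f'(1) g(2) by fastforce
  show "continuous_on (ball 0 1) (f \<circ> g)"
    using f'(2) g by (meson continuous_on_compose continuous_on_subset holomorphic_on_imp_continuous_on)
  show "\<forall>(U, \<phi>)\<in>A. \<forall>i. (\<lambda>\<zeta>. \<phi> ((f \<circ> g) \<zeta>) $ i) holomorphic_on {\<zeta> \<in> ball 0 1. (f \<circ> g) \<zeta> \<in> U}"
  proof clarify
    fix U \<phi> i assume "(U, \<phi>) \<in> A"
    then have "(\<lambda>\<zeta>. \<phi> (f \<zeta>) $ i) \<circ> g holomorphic_on {\<zeta> \<in> ball 0 1. (f \<circ> g) \<zeta> \<in> U}"
      using g by (intro holomorphic_on_compose_gen[OF _ f'(3)])
        (auto intro: holomorphic_on_subset simp: image_subset_iff)
    then show "(\<lambda>\<zeta>. \<phi> ((f \<circ> g) \<zeta>) $ i) holomorphic_on {\<zeta> \<in> ball 0 1. (f \<circ> g) \<zeta> \<in> U}"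
      by (simp add: o_def)
  qed
qed

text \<open>
  Moving \<open>b\<close> to the origin by a Moebius transformation makes the Poincare geodesic from \<open>a\<close> to \<open>b\<close> a
  straight segment, which is why later only segments through the origin occur.
\<close>

lemma recentred_disc:
  assumes f: "f \<in> holomorphic_discs A \<Omega>" and ab: "a \<in> ball 0 1" "b \<in> ball 0 1"
  obtains g c where "g \<in> holomorphic_discs A \<Omega>" "c \<in> ball 0 1" "g c = f a" "g 0 = f b"
    "poincare_dist a b = artanh (cmod c)"
proof
  show "f \<circ> Moebius_function 0 (- b) \<in> holomorphic_discs A \<Omega>"
    using ab f by (intro holomorphic_discs_compose Moebius_function_holomorphic)
      (auto simp: Moebius_function_norm_lt_1)
  show "Moebius_function 0 b a \<in> ball 0 1"
    using ab by (simp add: Moebius_function_norm_lt_1)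
  show "(f \<circ> Moebius_function 0 (- b)) (Moebius_function 0 b a) = f a"
    using ab Moebius_function_compose[of "- b" b a] by simp
  show "(f \<circ> Moebius_function 0 (- b)) 0 = f b"
    by (simp add: Moebius_function_of_zero)
  show "poincare_dist a b = artanh (cmod (Moebius_function 0 b a))"
    by (rule poincare_dist_Moebius)
qed

lemma poincare_dist_zero_right: "poincare_dist a 0 = artanh (cmod a)"
  by (simp add: poincare_dist_def)

text \<open>
  The Poincare distance is additive along segments that end at the origin, since these are
  geodesics. In terms of \<open>r = cmod c\<close> this is the subtraction formula for \<open>artanh\<close>.
\<close>

lemma poincare_dist_radial_split:
  assumes c: "c \<in> ball 0 1" and t: "0 \<le> t" "t \<le> 1"
  shows "poincare_dist c (of_real t * c) + poincare_dist (of_real t * c) 0 = artanh (cmod c)"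
proof -
  define r where "r = cmod c"
  have r: "0 \<le> r" "r < 1"
    using c by (simp_all add: r_def)
  have tr: "0 \<le> t * r" "t * r < 1"
    using r t mult_le_one[of t r] mult_right_mono[of t 1 r] by auto
  have trr: "t * r\<^sup>2 < 1"
    using tr r mult_right_mono[of r 1 "t * r"] by (simp add: power2_eq_square algebra_simps)
  have num: "cmod (c - of_real t * c) = r - t * r"
  proof -
    have "cmod (c - of_real t * c) = cmod (of_real (1 - t) * c)"
      by (simp add: algebra_simps)
    also have "\<dots> = (1 - t) * r"
      using t unfolding norm_mult norm_of_real r_def by simp
    finally show ?thesis
      by (simp add: algebra_simps)
  qed
  have den: "1 - cnj (of_real t * c) * c = of_real (1 - t * r\<^sup>2)"
    using complex_norm_square[of c] by (simp add: r_def mult.commute mult.left_commute)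
  have "cmod ((c - of_real t * c) / (1 - cnj (of_real t * c) * c)) = (r - t * r) / (1 - t * r\<^sup>2)"
    using trr unfolding norm_divide num den norm_of_real by simp
  then have "poincare_dist c (of_real t * c) = artanh ((r - t * r) / (1 - t * r\<^sup>2))"
    by (simp add: poincare_dist_def)
  also have "\<dots> = ln (((1 + r) * (1 - t * r)) / ((1 - r) * (1 + t * r))) / 2"
  proof -
    have "1 + (r - t * r) / (1 - t * r\<^sup>2) = ((1 + r) * (1 - t * r)) / (1 - t * r\<^sup>2)"
      "1 - (r - t * r) / (1 - t * r\<^sup>2) = ((1 - r) * (1 + t * r)) / (1 - t * r\<^sup>2)"
      using trr by (simp_all add: field_simps power2_eq_square)
    then show ?thesis
      using trr by (simp add: artanh_def)
  qed
  also have "\<dots> = artanh r - artanh (t * r)"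
  proof -
    have "ln (((1 + r) * (1 - t * r)) / ((1 - r) * (1 + t * r)))
        = (ln (1 + r) + ln (1 - t * r)) - (ln (1 - r) + ln (1 + t * r))"
      using r tr by (subst ln_div) (auto simp: ln_mult)
    moreover have "artanh r = (ln (1 + r) - ln (1 - r)) / 2"
      "artanh (t * r) = (ln (1 + t * r) - ln (1 - t * r)) / 2"
      using r tr by (simp_all add: artanh_def ln_div)
    ultimately show ?thesis
      by (simp add: field_simps)
  qed
  finally show ?thesis
    using t by (simp add: poincare_dist_zero_right norm_mult r_def)
qed

text \<open>
  Some disc of the chain leads from outside \<open>C\<close> into \<open>C\<close>. After recentring, the image of a radius is a
  connected set that joins the two points, so it meets the frontier of \<open>C\<close>; cutting the disc there
  preserves the total length.
\<close>

lemma disc_chain_crosses_frontier: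
  assumes "disc_chain A \<Omega> z cs w" "z \<notin> C" "w \<in> C"
  shows "\<exists>s\<in>frontier C. \<exists>cs1 cs2. disc_chain A \<Omega> z cs1 s \<and> disc_chain A \<Omega> s cs2 w \<and>
    chain_length cs1 + chain_length cs2 = chain_length cs"
  using assms
proof (induction cs arbitrary: z)
  case (Cons x cs)
  obtain f a b where x: "x = (f, a, b)"
    by (metis surj_pair)
  have f: "f \<in> holomorphic_discs A \<Omega>" "a \<in> ball 0 1" "b \<in> ball 0 1" "f a = z"
    and rest: "disc_chain A \<Omega> (f b) cs w"
    using Cons.prems(1) unfolding x by auto
  show ?case
  proof (cases "f b \<in> C")
    case False
    obtain s cs1 cs2 where s: "s \<in> frontier C" "disc_chain A \<Omega> (f b) cs1 s"
      "disc_chain A \<Omega> s cs2 w" "chain_length cs1 + chain_length cs2 = chain_length cs"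
      using Cons.IH[OF rest False Cons.prems(3)] by blast
    then show ?thesis
      using f by (intro bexI[OF _ s(1)] exI[of _ "x # cs1"] exI[of _ cs2]) (simp add: x)
  next
    case True
    obtain g c where g: "g \<in> holomorphic_discs A \<Omega>" "c \<in> ball 0 1" "g c = f a" "g 0 = f b"
      "poincare_dist a b = artanh (cmod c)"
      by (rule recentred_disc[OF f(1-3)])
    let ?S = "(\<lambda>t. g (of_real t * c)) ` {0..1::real}"
    have in_ball: "of_real t * c \<in> ball 0 1" if "t \<in> {0..1}" for t
      using that g(2) mult_right_mono[of t 1 "cmod c"] by (simp add: norm_mult)
    have "continuous_on (ball 0 1) g"
      using g(1) by (simp add: holomorphic_discs_def)
    then have "continuous_on {0..1} (\<lambda>t. g (of_real t * c))"
      by (rule continuous_on_compose2) (use in_ball in \<open>auto intro!: continuous_intros\<close>)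
    then have "connected ?S"
      by (rule connected_continuous_image) simp
    moreover have "g c \<in> ?S"
      by (rule image_eqI[of _ _ 1]) auto
    moreover have "g 0 \<in> ?S"
      by (rule image_eqI[of _ _ 0]) auto
    ultimately have "?S \<inter> frontier C \<noteq> {}"
      using connected_Int_frontier[of ?S C] True Cons.prems(2) f(4) g(3,4) by auto
    then obtain t where t: "t \<in> {0..1}" "g (of_real t * c) \<in> frontier C"
      by blast
    have "disc_chain A \<Omega> z [(g, c, of_real t * c)] (g (of_real t * c))"
      using g f(4) in_ball[OF t(1)] by simp
    moreover have "disc_chain A \<Omega> (g (of_real t * c)) ((g, of_real t * c, 0) # cs) w"
      using g rest in_ball[OF t(1)] by simp
    moreover have "chain_length [(g, c, of_real t * c)] + chain_length ((g, of_real t * c, 0) # cs)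
        = chain_length (x # cs)"
      using poincare_dist_radial_split[OF g(2), of t] t(1) g(5) by (simp add: x)
    ultimately show ?thesis
      using t(2) by blast
  qed
qed simp

lemma norm_vector_smult: "norm (c *s (v :: complex ^ 'n)) = cmod c * norm v"
  by (simp add: norm_vec_def norm_mult L2_set_right_distrib)

lemma bounded_linear_smult_left: "bounded_linear (\<lambda>c. c *s (v :: complex ^ 'n))"
  by (intro linear_conv_bounded_linear[THEN iffD1] linearI) (simp_all add: vec_eq_iff algebra_simps)

lemma chart_at:
  assumes A: "complex_atlas A" and \<Omega>: "open \<Omega>" "p \<in> \<Omega>"
  obtains V \<phi> R where "(V, \<phi>) \<in> A" "open V" "p \<in> V" "0 < R" "ball (\<phi> p) R \<subseteq> \<phi> ` (V \<inter> \<Omega>)"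
    "continuous_on V \<phi>" "continuous_on (\<phi> ` V) (inv_into V \<phi>)" "inj_on \<phi> V"
proof -
  obtain V \<phi> where V: "(V, \<phi>) \<in> A" "p \<in> V"
    using A unfolding complex_atlas_def by blast
  then obtain \<psi> where \<psi>: "open V" "open (\<phi> ` V)" "homeomorphism V (\<phi> ` V) \<phi> \<psi>"
    using A unfolding complex_atlas_def by blast
  have inj: "inj_on \<phi> V"
    using \<psi>(3) by (metis homeomorphism_def inj_on_inverseI)
  have "continuous_on (\<phi> ` V) (inv_into V \<phi>)"
  proof (rule continuous_on_eq[OF homeomorphism_cont2[OF \<psi>(3)]])
    show "\<psi> y = inv_into V \<phi> y" if "y \<in> \<phi> ` V" for y
      using that homeomorphism_apply1[OF \<psi>(3)] inv_into_f_f[OF inj] by auto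
  qed
  moreover have "open (\<phi> ` (V \<inter> \<Omega>))"
    using homeomorphism_imp_open_map[OF \<psi>(3), of "V \<inter> \<Omega>"] \<Omega>(1) openin_open_trans[OF _ \<psi>(2)]
    by (simp add: openin_open_Int)
  then obtain R where "0 < R" "ball (\<phi> p) R \<subseteq> \<phi> ` (V \<inter> \<Omega>)"
    using V(2) \<Omega>(2) open_contains_ball by blast
  ultimately show thesis
    using that[OF V(1) \<psi>(1) V(2)] homeomorphism_cont1[OF \<psi>(3)] inj by blast
qed

text \<open>
  In a chart the disc is a complex line. Read in another chart it is composed with a transition map,
  whose derivative is complex linear by the definition of the atlas.
\<close>

lemma affine_disc:
  fixes v :: "complex ^ 'n"
  assumes A: "complex_atlas A" and V: "(V, \<phi>) \<in> A" "continuous_on (\<phi> ` V) (inv_into V \<phi>)"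
    and ball: "ball y R \<subseteq> \<phi> ` (V \<inter> \<Omega>)" and inj: "inj_on \<phi> V" and v: "norm v < R"
  shows "(\<lambda>\<zeta>. inv_into V \<phi> (y + \<zeta> *s v)) \<in> holomorphic_discs A \<Omega>"
  unfolding holomorphic_discs_def
proof (intro CollectI conjI)
  define l where "l \<zeta> = y + \<zeta> *s v" for \<zeta>
  have l_ball: "l \<zeta> \<in> ball y R" if "\<zeta> \<in> ball 0 1" for \<zeta>
  proof -
    have "cmod \<zeta> * norm v \<le> 1 * norm v"
      using that by (intro mult_right_mono) auto
    then show ?thesis
      using v by (simp add: l_def dist_norm norm_vector_smult)
  qed
  have l_img: "l \<zeta> \<in> \<phi> ` (V \<inter> \<Omega>)" if "\<zeta> \<in> ball 0 1" for \<zeta>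
    using l_ball[OF that] ball by blast
  have l_deriv: "(l has_derivative (\<lambda>h. h *s v)) (at \<zeta>)" for \<zeta>
    unfolding l_def
    by (auto intro!: derivative_eq_intros bounded_linear_imp_has_derivative bounded_linear_smult_left)
  have inv: "inv_into V \<phi> (\<phi> x) = x" if "x \<in> V" for x
    using inv_into_f_f[OF inj that] .
  show "(\<lambda>\<zeta>. inv_into V \<phi> (y + \<zeta> *s v)) ` ball 0 1 \<subseteq> \<Omega>"
    using l_img inv by (force simp flip: l_def)
  have "continuous_on (ball 0 1) l"
    using l_deriv has_derivative_continuous by (blast intro: continuous_at_imp_continuous_on)
  then show "continuous_on (ball 0 1) (\<lambda>\<zeta>. inv_into V \<phi> (y + \<zeta> *s v))"
    using l_img unfolding l_def[symmetric] by (intro continuous_on_compose2[OF V(2)]) blast+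
  have "(\<lambda>\<zeta>. \<theta> (inv_into V \<phi> (l \<zeta>)) $ i) holomorphic_on
      {\<zeta> \<in> ball 0 1. inv_into V \<phi> (l \<zeta>) \<in> W}" if W: "(W, \<theta>) \<in> A" for W \<theta> i
    unfolding holomorphic_on_def
  proof
    fix \<zeta> assume \<zeta>: "\<zeta> \<in> {\<zeta> \<in> ball 0 1. inv_into V \<phi> (l \<zeta>) \<in> W}"
    then obtain x where x: "x \<in> V" "l \<zeta> = \<phi> x"
      using l_img by blast
    then have "l \<zeta> \<in> \<phi> ` (V \<inter> W)"
      using \<zeta> inv by auto
    moreover have "holomorphic_map_on (\<theta> \<circ> inv_into V \<phi>) (\<phi> ` (V \<inter> W))"
      using A V(1) W unfolding complex_atlas_def by blast
    ultimately obtain f' where f': "((\<theta> \<circ> inv_into V \<phi>) has_derivative f') (at (l \<zeta>))"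
      "\<And>c v. f' (c *s v) = c *s f' v"
      unfolding holomorphic_map_on_def by blast
    have "((\<lambda>\<zeta>. ((\<theta> \<circ> inv_into V \<phi>) \<circ> l) \<zeta> $ i) has_derivative (\<lambda>h. (f' \<circ> (\<lambda>h. h *s v)) h $ i)) (at \<zeta>)"
      by (rule bounded_linear.has_derivative[OF bounded_linear_vec_nth
          diff_chain_at[OF l_deriv f'(1)]])
    then have "((\<lambda>\<zeta>. \<theta> (inv_into V \<phi> (l \<zeta>)) $ i) has_field_derivative (f' v $ i)) (at \<zeta>)"
      by (simp add: has_field_derivative_def f'(2) o_def mult_commute_abs)
    then show "(\<lambda>\<zeta>. \<theta> (inv_into V \<phi> (l \<zeta>)) $ i) field_differentiable
        at \<zeta> within {\<zeta> \<in> ball 0 1. inv_into V \<phi> (l \<zeta>) \<in> W}"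
      using field_differentiable_at_within field_differentiable_def by blast
  qed
  then show "\<forall>(W, \<theta>)\<in>A. \<forall>i. (\<lambda>\<zeta>. \<theta> (inv_into V \<phi> (y + \<zeta> *s v)) $ i) holomorphic_on
      {\<zeta> \<in> ball 0 1. inv_into V \<phi> (y + \<zeta> *s v) \<in> W}"
    unfolding l_def by blast
qed

text \<open>
  The parameter \<open>s\<close> is fixed and the disc depends on \<open>q\<close>, so that one Poincare distance, that of \<open>0\<close>
  and \<open>s\<close>, bounds the Kobayashi distance to all nearby points at once.
\<close>

lemma discs_through_nearby_points:
  assumes A: "complex_atlas A" and \<Omega>: "open \<Omega>" "p \<in> \<Omega>" and s: "0 < s"
  obtains U where "open U" "p \<in> U" "U \<subseteq> \<Omega>"
    "\<And>q. q \<in> U \<Longrightarrow> \<exists>f\<in>holomorphic_discs A \<Omega>. f 0 = p \<and> f (complex_of_real s) = q"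
proof -
  obtain V \<phi> R where V: "(V, \<phi>) \<in> A" "open V" "p \<in> V" "0 < R" "ball (\<phi> p) R \<subseteq> \<phi> ` (V \<inter> \<Omega>)"
    "continuous_on V \<phi>" "continuous_on (\<phi> ` V) (inv_into V \<phi>)" "inj_on \<phi> V"
    using chart_at[OF A \<Omega>] .
  show thesis
  proof (rule that[of "(V \<inter> \<phi> -` ball (\<phi> p) (s * R)) \<inter> \<Omega>"])
    show "open ((V \<inter> \<phi> -` ball (\<phi> p) (s * R)) \<inter> \<Omega>)"
      by (intro open_Int[OF continuous_open_preimage[OF V(6,2) open_ball] \<Omega>(1)])
    show "p \<in> (V \<inter> \<phi> -` ball (\<phi> p) (s * R)) \<inter> \<Omega>"
      using V s \<Omega> by simp
    fix q assume q: "q \<in> (V \<inter> \<phi> -` ball (\<phi> p) (s * R)) \<inter> \<Omega>"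
    define v where "v = (1 / complex_of_real s) *s (\<phi> q - \<phi> p)"
    have "norm v < R"
      using q s unfolding v_def norm_vector_smult
      by (simp add: dist_norm norm_minus_commute norm_divide field_simps)
    then have "(\<lambda>\<zeta>. inv_into V \<phi> (\<phi> p + \<zeta> *s v)) \<in> holomorphic_discs A \<Omega>"
      by (rule affine_disc[OF A V(1,7,5,8)])
    moreover have "inv_into V \<phi> (\<phi> p + 0 *s v) = p"
      using inv_into_f_f[OF V(8,3)] by simp
    moreover have "complex_of_real s *s v = \<phi> q - \<phi> p"
      using s by (simp add: v_def vector_smult_assoc)
    then have "inv_into V \<phi> (\<phi> p + complex_of_real s *s v) = q"
      using inv_into_f_f[OF V(8), of q] q by simp
    ultimately show "\<exists>f\<in>holomorphic_discs A \<Omega>. f 0 = p \<and> f (complex_of_real s) = q"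
      by (intro bexI[of _ "\<lambda>\<zeta>. inv_into V \<phi> (\<phi> p + \<zeta> *s v)"]) auto
  qed blast
qed

text \<open>
  The points that can be reached from \<open>z\<close> form an open and closed subset of \<open>\<Omega>\<close>: two points near
  \<open>p\<close> are joined by two discs that meet in \<open>p\<close>.
\<close>

lemma disc_chain_exists:
  assumes A: "complex_atlas A" and \<Omega>: "open \<Omega>" "connected \<Omega>" and zw: "z \<in> \<Omega>" "w \<in> \<Omega>"
  shows "\<exists>cs. disc_chain A \<Omega> z cs w"
proof (rule connected_induction_simple[OF \<Omega>(2) zw, where P = "\<lambda>x. \<exists>cs. disc_chain A \<Omega> z cs x"])
  show "\<exists>cs. disc_chain A \<Omega> z cs z"
    by (intro exI[of _ "[]"]) simp
  fix p assume p: "p \<in> \<Omega>"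
  obtain U where U: "open U" "p \<in> U" "U \<subseteq> \<Omega>"
    "\<And>q. q \<in> U \<Longrightarrow> \<exists>f\<in>holomorphic_discs A \<Omega>. f 0 = p \<and> f (complex_of_real (1 / 2)) = q"
    by (rule discs_through_nearby_points[OF A \<Omega>(1) p, of "1 / 2"]) auto
  have "\<exists>cs. disc_chain A \<Omega> z cs y" if xy: "x \<in> U" "y \<in> U" "disc_chain A \<Omega> z cs x" for x y cs
  proof -
    obtain f g where f: "f \<in> holomorphic_discs A \<Omega>" "f 0 = p" "f (complex_of_real (1 / 2)) = x"
      and g: "g \<in> holomorphic_discs A \<Omega>" "g 0 = p" "g (complex_of_real (1 / 2)) = y"
      using U(4)[OF xy(1)] U(4)[OF xy(2)] by blast
    have "disc_chain A \<Omega> x [(f, complex_of_real (1 / 2), 0), (g, 0, complex_of_real (1 / 2))] y"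
      using f g by (simp add: norm_divide)
    then show ?thesis
      using disc_chain_append[OF xy(3)] by blast
  qed
  then show "\<exists>T. openin (top_of_set \<Omega>) T \<and> p \<in> T \<and> (\<forall>x\<in>T. \<forall>y\<in>T.
      (\<exists>cs. disc_chain A \<Omega> z cs x) \<longrightarrow> (\<exists>cs. disc_chain A \<Omega> z cs y))"
    using U(1-3) by (intro exI[of _ U]) (auto intro: open_subset)
qed

lemma kobayashi_dist_small_near:
  assumes A: "complex_atlas A" and \<Omega>: "open \<Omega>" "p \<in> \<Omega>" and e: "0 < e"
  shows "\<exists>U. open U \<and> p \<in> U \<and> (\<forall>q\<in>U \<inter> \<Omega>. kobayashi_dist A \<Omega> p q < e)"
proof -
  \<comment> \<open>With this \<open>s\<close> the Poincare distance of \<open>0\<close> and \<open>s\<close> is \<open>e / 2\<close>.\<close>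
  define s where "s = tanh (e / 2)"
  have s: "0 < s" "s < 1" "artanh s = e / 2"
    using e by (simp_all add: s_def tanh_real_lt_1 artanh_tanh_real)
  obtain U where U: "open U" "p \<in> U" "U \<subseteq> \<Omega>"
    "\<And>q. q \<in> U \<Longrightarrow> \<exists>f\<in>holomorphic_discs A \<Omega>. f 0 = p \<and> f (complex_of_real s) = q"
    by (rule discs_through_nearby_points[OF A \<Omega> s(1)]) (rule that; assumption)
  have "kobayashi_dist A \<Omega> p q < e" if "q \<in> U" for q
  proof -
    obtain f where f: "f \<in> holomorphic_discs A \<Omega>" "f 0 = p" "f (complex_of_real s) = q"
      using U(4)[OF \<open>q \<in> U\<close>] by blast
    have "disc_chain A \<Omega> p [(f, 0, complex_of_real s)] q"
      using f s by simp
    then have "kobayashi_dist A \<Omega> p q \<le> poincare_dist 0 (complex_of_real s)"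
      using kobayashi_dist_le by fastforce
    also have "\<dots> < e"
      using s e by (simp add: poincare_dist_def)
    finally show ?thesis .
  qed
  then show ?thesis
    using U(1,2) by blast
qed

lemma compact_neighbourhood_in_manifold:
  fixes A :: "('a::{t2_space,second_countable_topology} set \<times> ('a \<Rightarrow> complex ^ 'n)) set" and \<Omega> :: "'a set"
  assumes A: "complex_atlas A" and \<Omega>: "open \<Omega>" "p \<in> \<Omega>"
  shows "\<exists>C. compact C \<and> C \<subseteq> \<Omega> \<and> p \<in> interior C"
proof -
  obtain V \<phi> R where V: "(V, \<phi>) \<in> A" "open V" "p \<in> V" "0 < R" "ball (\<phi> p) R \<subseteq> \<phi> ` (V \<inter> \<Omega>)"
    "continuous_on V \<phi>" "continuous_on (\<phi> ` V) (inv_into V \<phi>)" "inj_on \<phi> V"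
    using chart_at[OF A \<Omega>] .
  let ?C = "inv_into V \<phi> ` cball (\<phi> p) (R / 2)"
  have sub: "cball (\<phi> p) (R / 2) \<subseteq> \<phi> ` (V \<inter> \<Omega>)"
    using V(4,5) by fastforce
  have "compact ?C"
    using sub by (intro compact_continuous_image continuous_on_subset[OF V(7)]) auto
  moreover have "?C \<subseteq> \<Omega>"
    using sub inv_into_f_f[OF V(8)] by fastforce
  moreover have "p \<in> interior ?C"
  proof (rule interiorI)
    show "open (V \<inter> \<phi> -` ball (\<phi> p) (R / 2))"
      by (rule continuous_open_preimage[OF V(6,2)]) simp
    show "p \<in> V \<inter> \<phi> -` ball (\<phi> p) (R / 2)"
      using V(3,4) by simp
    show "V \<inter> \<phi> -` ball (\<phi> p) (R / 2) \<subseteq> ?C"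
    proof
      fix q assume q: "q \<in> V \<inter> \<phi> -` ball (\<phi> p) (R / 2)"
      then show "q \<in> ?C"
        using inv_into_f_f[OF V(8), of q] by (intro image_eqI[of _ _ "\<phi> q"]) auto
    qed
  qed
  ultimately show ?thesis
    by blast
qed

lemma inner_distance_kobayashi:
  assumes A: "complex_atlas A" and \<Omega>: "open \<Omega>" "connected \<Omega>"
    and hyp: "kobayashi_hyperbolic A \<Omega>"
  shows "inner_distance \<Omega> (kobayashi_dist A \<Omega>)"
proof
  interpret M: Metric_space \<Omega> "\<lambda>z w. if z \<in> \<Omega> \<and> w \<in> \<Omega> then kobayashi_dist A \<Omega> z w else 0"
    using hyp by (simp add: kobayashi_hyperbolic_def)
  show "kobayashi_dist A \<Omega> x x = 0" if "x \<in> \<Omega>" for x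
    using M.zero[of x x] that by simp
  show "0 < kobayashi_dist A \<Omega> x y" if "x \<in> \<Omega>" "y \<in> \<Omega>" "x \<noteq> y" for x y
    using M.zero[of x y] M.nonneg[of x y] that by simp
  show "kobayashi_dist A \<Omega> x y = kobayashi_dist A \<Omega> y x" if "x \<in> \<Omega>" "y \<in> \<Omega>" for x y
    using M.commute[of x y] that by simp
  show "kobayashi_dist A \<Omega> x z \<le> kobayashi_dist A \<Omega> x y + kobayashi_dist A \<Omega> y z"
    if "x \<in> \<Omega>" "y \<in> \<Omega>" "z \<in> \<Omega>" for x y z
    using M.triangle[of x y z] that by simp
  show "open \<Omega>"
    by (rule \<Omega>(1))
  show "\<exists>U. open U \<and> p \<in> U \<and> (\<forall>q\<in>U \<inter> \<Omega>. kobayashi_dist A \<Omega> p q < e)"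
    if "p \<in> \<Omega>" "0 < e" for p e
    by (rule kobayashi_dist_small_near[OF A \<Omega>(1) that])
  show "\<exists>C. compact C \<and> C \<subseteq> \<Omega> \<and> p \<in> interior C" if "p \<in> \<Omega>" for p
    by (rule compact_neighbourhood_in_manifold[OF A \<Omega>(1) that])
  show "\<exists>s\<in>frontier C. kobayashi_dist A \<Omega> w s + kobayashi_dist A \<Omega> s p \<le> kobayashi_dist A \<Omega> w p + e"
    if C: "compact C" "C \<subseteq> \<Omega>" "p \<in> interior C" and w: "w \<in> \<Omega> - C" and e: "0 < e" for C p w e
  proof -
    have p: "p \<in> C"
      using C(3) interior_subset by blast
    have ex: "\<exists>cs. disc_chain A \<Omega> w cs p"
      using disc_chain_exists[OF A \<Omega>, of w p] w p C(2) by blast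
    obtain cs where cs: "disc_chain A \<Omega> w cs p"
      "chain_length cs < kobayashi_dist A \<Omega> w p + e"
      by (rule kobayashi_dist_approx[OF ex e])
    obtain s cs1 cs2 where s: "s \<in> frontier C" "disc_chain A \<Omega> w cs1 s" "disc_chain A \<Omega> s cs2 p"
      "chain_length cs1 + chain_length cs2 = chain_length cs"
      using disc_chain_crosses_frontier[OF cs(1) _ p] w by blast
    have "kobayashi_dist A \<Omega> w s + kobayashi_dist A \<Omega> s p \<le> kobayashi_dist A \<Omega> w p + e"
      using kobayashi_dist_le[OF s(2)] kobayashi_dist_le[OF s(3)] s(4) cs(2) by linarith
    then show ?thesis
      using s(1) by blast
  qed
qed

theorem theorem5p3:
  fixes A :: "('a::{t2_space,second_countable_topology} set \<times> ('a \<Rightarrow> complex ^ 'n)) set"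
    and \<Omega> :: "'a set" and K :: "nat \<Rightarrow> 'a set" and z0 :: 'a
  assumes "complex_atlas A"
    and "open \<Omega>" and "connected \<Omega>" and "\<Omega> \<noteq> UNIV"
    and "kobayashi_hyperbolic A \<Omega>"
    and "compact_exhaustion (closure \<Omega>) K"
    and "sequentially_compact_space (end_topology \<Omega> K)"
    and "z0 \<in> \<Omega>"
  shows
    "((\<forall>x\<in>end_boundary \<Omega> K. \<forall>z\<in>\<Omega>. \<exists>L::real.
          ((\<lambda>w. kobayashi_dist A \<Omega> z (projl w) - kobayashi_dist A \<Omega> z0 (projl w)) \<longlongrightarrow> L)
            (atin_within (end_topology \<Omega> K) x (Inl ` \<Omega>)))
      \<longleftrightarrow> (\<forall>x\<in>end_boundary \<Omega> K. is_singleton (horo_limits A \<Omega> K x)))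
     \<and> ((\<forall>x\<in>end_boundary \<Omega> K. is_singleton (horo_limits A \<Omega> K x))
      \<longleftrightarrow> (\<exists>G. continuous_map (end_topology \<Omega> K)
              (subtopology (quot_topology \<Omega>) (metric_compactification A \<Omega>)) G \<and>
            (\<forall>w\<in>\<Omega>. G (Inl w) = kobayashi_embedding A \<Omega> w)))"
proof -
  interpret inner_distance \<Omega> "kobayashi_dist A \<Omega>"
    by (rule inner_distance_kobayashi[OF assms(1-3,5)])
  interpret inner_distance_ends \<Omega> "kobayashi_dist A \<Omega>" K z0
    by unfold_locales (rule assms)+
  have embedding: "embedding = kobayashi_embedding A \<Omega>"
    by (simp add: fun_eq_iff embedding_def kobayashi_embedding_def)
  have compactification: "metric_compactification A \<Omega> = quot_topology \<Omega> closure_of embedding ` \<Omega>"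
    by (simp add: metric_compactification_def embedding)
  have limits: "boundary_limits = horo_limits A \<Omega> K"
    by (simp add: fun_eq_iff boundary_limits_def horo_limits_def compactification embedding)
  show ?thesis
    using limits_iff_singleton_iff_extension unfolding limits compactification unfolding embedding .
qed

end
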